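(* Let $n\ge2$, $1\le d\le n-1$ and $c=n-d$. (1) If $u=u_{>0}(t)$ with $t\in\mathbb R$, then $$u=\prod_{(i,j)\in B(d,c)}x_{d-i+j}\left(t\,\frac{\sin\left((i+j-1)\frac{\pi}{n}\right)}{\sin\left((d-i+j)\frac{\pi}{n}\right)}\right),$$ where the order of multiplication is increasing for the partial order $\preceq$ on $B(d,c)$, so that the indices of the $x_{d-i+j}$ spell a reduced expression of $w^{\{\hat d\}}$. (2) An element $u\in\mathcal V_{d,n}$ lies in $\mathcal V_{d,n}(\mathbb R_{>0})$ if and only if $s_{(m^k)}(u)>0$ for all rectangular partitions $(m^k)$ with $1\le m\le c$ and $1\le k\le d$.
   Context: The variety $\mathcal V_{d,n}$: Let $B^-\subset GL_n(\mathbb C)$ be the invertible lower-triangular matrices, $U^+\subset GL_n(\mathbb C)$ the unipotent upper-triangular matrices, $e_i$ the $n\times n$ matrix with unique nonzero entry $1$ in position $(i,i+1)$, $e=\sum_{i=1}^{n-1}e_i$, and $(U^+)^e=\{u\in U^+: ueu^{-1}=e\}$; this consists of the upper-triangular unipotent Toeplitz matrices $u$ with $(i,j)$ entry $x_{j-i}(u)$ (coordinate functions $x_k$, with $x_0=1$). Let $W\subset GL_n(\mathbb C)$ be the group of permutation matrices, $s_k$ the adjacent transposition $(k,k+1)$, $w_0$ the order-reversing permutation; for $K\subset\{1,\dots,n-1\}$ let $w_K$ be the longest element of $\langle s_k:k\in K\rangle$ and $w^K=w_0w_K$; let $\{\hat d\}=\{1,\dots,n-1\}\setminus\{d\}$.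 Then $\mathcal V_{d,n}:=(U^+)^e\cap\overline{B^-w^{\{\hat d\}}B^-}$ (closure in $GL_n(\mathbb C)$). On $\mathcal V_{d,n}$ one has $x_{d+1}=\dots=x_{n-1}=0$. Positive part: a matrix is totally nonnegative if all its minors are nonnegative reals. $\mathcal V_{d,n}(\mathbb R_{>0})$ is the set of totally nonnegative (real) matrices in $\mathcal V_{d,n}\cap B^-w^{\{\hat d\}}B^-$. The map $u_{>0}$: for $z_1,\dots,z_d\in\mathbb C$ let $u_n(z_1,\dots,z_d)$ be the $n\times n$ upper-triangular unipotent Toeplitz matrix with $(i,i+j)$ entry the elementary symmetric polynomial $E_j(z_1,\dots,z_d)$ for $1\le j\le d$ and $0$ for $j>d$. Put $\zeta^a:=\exp(2\pi\sqrt{-1}\,a/n)$ and $u_{>0}(t):=u_n(t\zeta^{-\frac{d-1}2},t\zeta^{-\frac{d-1}2+1},\dots,t\zeta^{\frac{d-1}2})$. One-parameter subgroups and ordering (in part (1), $x_i(\cdot)$ denotes these, not coordinate functions): $x_i(a):=\exp(ae_i)=1+ae_i$ for $1\le i\le n-1$. $B(d,c)=\{(i,j): 1\le i\le d,\ 1\le j\le c\}$ with partial order $(i,j)\preceq(i',j')\iff i\ge i'$ and $j\ge j'$ (smallest element $(d,c)$, largest $(1,1)$). A product over $B(d,c)$ means that the factors are multiplied from left to right in any total order refining $\preceq$, in increasing order (the product does not depend on the choice); with this ordering $\prod_{(i,j)\in B(d,c)}s_{d-i+j}=w^{\{\hat d\}}$ is a reduced expression. Functions: $(m^k)=(m,\dots,m,0,\dots,0)$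 with $m$ occurring $k$ times. For a partition $\lambda$ with at most $d$ parts and $\lambda_1\le c$, with conjugate $\lambda^t=(\lambda^t_1,\dots,\lambda^t_c)$, and for $u\in\mathcal V_{d,n}$, $s_\lambda(u)=\det\left(x_{\lambda^t_i+j-i}(u)\right)_{i,j=1,\dots,c}$ where $x_0=1$ and $x_k=0$ for $k\notin\{0,\dots,d\}$. *)

theory Defs
  imports
    "HOL-Library.Nonpos_Ints"
    "Jordan_Normal_Form.Determinant"
    "Jordan_Normal_Form.Gauss_Jordan_Elimination"
    "Jordan_Normal_Form.DL_Submatrix"
begin

text \<open>
  Matrix entries are numbered from 0 in the matrix library, so the mathematical entry in
  position (i, j) is the entry (i - 1, j - 1) below. All other indices (of e, s, x,
  of the variables z and of boxes) start at 1.
\<close>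

subsection \<open>Subgroups of the general linear group\<close>

definition GLn :: "nat \<Rightarrow> complex mat set" where
  "GLn n = {g \<in> carrier_mat n n. invertible_mat g}"

definition B_minus :: "nat \<Rightarrow> complex mat set" where
  "B_minus n = {b \<in> GLn n. \<forall>i<n. \<forall>j<n. i < j \<longrightarrow> b $$ (i, j) = 0}"

definition U_plus :: "nat \<Rightarrow> complex mat set" where
  "U_plus n = {u \<in> carrier_mat n n. upper_triangular u \<and> (\<forall>i<n. u $$ (i, i) = 1)}"

definition e_mat :: "nat \<Rightarrow> nat \<Rightarrow> complex mat" where
  "e_mat n i = mat n n (\<lambda>(r, c). if r + 1 = i \<and> c + 1 = i + 1 then 1 else 0)"

definition e_sum :: "nat \<Rightarrow> complex mat" where
  "e_sum n = mat n n (\<lambda>(r, c). \<Sum>i = 1..n - 1. e_mat n i $$ (r, c))"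

text \<open>The witness \<open>v\<close> is the inverse of \<open>u\<close>.\<close>

definition U_plus_e :: "nat \<Rightarrow> complex mat set" where
  "U_plus_e n = {u \<in> U_plus n.
     \<exists>v \<in> carrier_mat n n. inverts_mat u v \<and> inverts_mat v u \<and> u * e_sum n * v = e_sum n}"

definition mat_list_prod :: "nat \<Rightarrow> complex mat list \<Rightarrow> complex mat" where
  "mat_list_prod n As = foldr (*) As (1\<^sub>m n)"

subsection \<open>Permutation matrices\<close>

definition s_mat :: "nat \<Rightarrow> nat \<Rightarrow> complex mat" where
  "s_mat n k = swaprows_mat n (k - 1) k"

definition s_word :: "nat \<Rightarrow> nat list \<Rightarrow> complex mat" where
  "s_word n ks = mat_list_prod n (map (s_mat n) ks)"

text \<open>The generators are involutions, so the words in them already form a group.\<close>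

definition parabolic :: "nat \<Rightarrow> nat set \<Rightarrow> complex mat set" where
  "parabolic n K = {s_word n ks | ks. set ks \<subseteq> K}"

definition weyl_length :: "nat \<Rightarrow> complex mat \<Rightarrow> nat" where
  "weyl_length n w = (LEAST l. \<exists>ks. set ks \<subseteq> {1..n - 1} \<and> s_word n ks = w \<and> length ks = l)"

definition reduced_expression :: "nat \<Rightarrow> nat list \<Rightarrow> complex mat \<Rightarrow> bool" where
  "reduced_expression n ks w \<longleftrightarrow>
     set ks \<subseteq> {1..n - 1} \<and> s_word n ks = w \<and> length ks = weyl_length n w"

definition w_zero :: "nat \<Rightarrow> complex mat" where
  "w_zero n = mat n n (\<lambda>(i, j). if i + j = n - 1 then 1 else 0)"

definition w_longest :: "nat \<Rightarrow> nat set \<Rightarrow> complex mat" where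
  "w_longest n K = (THE w. w \<in> parabolic n K \<and>
     (\<forall>v \<in> parabolic n K. v \<noteq> w \<longrightarrow> weyl_length n v < weyl_length n w))"

definition w_upper :: "nat \<Rightarrow> nat set \<Rightarrow> complex mat" where
  "w_upper n K = w_zero n * w_longest n K"

definition hat :: "nat \<Rightarrow> nat \<Rightarrow> nat set" where
  "hat n d = {1..n - 1} - {d}"

definition bruhat_cell :: "nat \<Rightarrow> complex mat \<Rightarrow> complex mat set" where
  "bruhat_cell n w = {b * w * b' | b b'. b \<in> B_minus n \<and> b' \<in> B_minus n}"

subsection \<open>The variety and its positive part\<close>

inductive_set poly_funs :: "nat \<Rightarrow> (complex mat \<Rightarrow> complex) set" for n :: nat where
  const: "(\<lambda>_. a) \<in> poly_funs n"
| entry: "i < n \<Longrightarrow> j < n \<Longrightarrow> (\<lambda>g. g $$ (i, j)) \<in> poly_funs n"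
| add: "f \<in> poly_funs n \<Longrightarrow> h \<in> poly_funs n \<Longrightarrow> (\<lambda>g. f g + h g) \<in> poly_funs n"
| mult: "f \<in> poly_funs n \<Longrightarrow> h \<in> poly_funs n \<Longrightarrow> (\<lambda>g. f g * h g) \<in> poly_funs n"

text \<open>
  Zariski closure in the general linear group. Every regular function there is a polynomial in the
  entries divided by a power of the determinant, so polynomials in the entries suffice. For
  Bruhat cells, which are constructible, this is also the closure in the Euclidean topology.
\<close>

definition zariski_closure :: "nat \<Rightarrow> complex mat set \<Rightarrow> complex mat set" where
  "zariski_closure n S =
     {g \<in> GLn n. \<forall>f \<in> poly_funs n. (\<forall>x \<in> S. f x = 0) \<longrightarrow> f g = 0}"

definition V_var :: "nat \<Rightarrow> nat \<Rightarrow> complex mat set" where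
  "V_var d n = U_plus_e n \<inter> zariski_closure n (bruhat_cell n (w_upper n (hat n d)))"

definition totally_nonneg :: "complex mat \<Rightarrow> bool" where
  "totally_nonneg A \<longleftrightarrow>
     (\<forall>I J. I \<subseteq> {..<dim_row A} \<and> J \<subseteq> {..<dim_col A} \<and> card I = card J \<longrightarrow>
        det (submatrix A I J) \<in> \<real>\<^sub>\<ge>\<^sub>0)"

definition V_pos :: "nat \<Rightarrow> nat \<Rightarrow> complex mat set" where
  "V_pos d n = {u \<in> V_var d n \<inter> bruhat_cell n (w_upper n (hat n d)). totally_nonneg u}"

subsection \<open>The map from the real line\<close>

definition elem_sym :: "nat \<Rightarrow> (nat \<Rightarrow> complex) \<Rightarrow> nat \<Rightarrow> complex" where
  "elem_sym d z j = (\<Sum>S | S \<subseteq> {1..d} \<and> card S = j. \<Prod>l\<in>S. z l)"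

definition u_toeplitz :: "nat \<Rightarrow> nat \<Rightarrow> (nat \<Rightarrow> complex) \<Rightarrow> complex mat" where
  "u_toeplitz n d z = mat n n (\<lambda>(r, c).
     if r = c then 1
     else if r < c \<and> c - r \<le> d then elem_sym d z (c - r)
     else 0)"

definition zeta_pow :: "nat \<Rightarrow> real \<Rightarrow> complex" where
  "zeta_pow n a = exp (2 * of_real pi * \<i> * of_real a / of_nat n)"

definition u_pos :: "nat \<Rightarrow> nat \<Rightarrow> real \<Rightarrow> complex mat" where
  "u_pos d n t = u_toeplitz n d
     (\<lambda>l. of_real t * zeta_pow n (- ((real d - 1) / 2) + (real l - 1)))"

subsection \<open>Ordered products over a rectangle of boxes\<close>

definition x_mat :: "nat \<Rightarrow> nat \<Rightarrow> complex \<Rightarrow> complex mat" where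
  "x_mat n i a = 1\<^sub>m n + a \<cdot>\<^sub>m e_mat n i"

definition boxes :: "nat \<Rightarrow> nat \<Rightarrow> (nat \<times> nat) set" where
  "boxes d c = {1..d} \<times> {1..c}"

definition box_le :: "nat \<times> nat \<Rightarrow> nat \<times> nat \<Rightarrow> bool" where
  "box_le p q \<longleftrightarrow> fst p \<ge> fst q \<and> snd p \<ge> snd q"

text \<open>
  Lists enumerating the boxes increasingly in some total order refining \<open>box_le\<close>: no box is
  preceded by a larger one.
\<close>

definition increasing_enum :: "nat \<Rightarrow> nat \<Rightarrow> (nat \<times> nat) list \<Rightarrow> bool" where
  "increasing_enum d c ps \<longleftrightarrow>
     distinct ps \<and> set ps = boxes d c \<and> sorted_wrt (\<lambda>p q. \<not> box_le q p) ps"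

lemma ex_increasing_enum: "\<exists>ps. increasing_enum d c ps"
proof -
  define f where "f = (\<lambda>p :: nat \<times> nat. fst p + snd p)"
  have "finite (boxes d c)"
    by (simp add: boxes_def)
  then obtain xs where xs: "set xs = boxes d c" "distinct xs"
    using finite_distinct_list by blast
  define ps where "ps = rev (sort_key f xs)"
  have ps: "set ps = boxes d c" "distinct ps"
    using xs by (simp_all add: ps_def)
  have desc: "f (ps ! l) \<le> f (ps ! k)" if "k < l" "l < length ps" for k l
  proof -
    have "sorted_wrt (\<lambda>p q. f p \<le> f q) (rev ps)"
      using sorted_sort_key[of f xs] by (simp add: ps_def sorted_map)
    then show ?thesis
      using that unfolding sorted_wrt_rev by (auto simp: sorted_wrt_iff_nth_less)
  qed
  have "\<not> box_le (ps ! l) (ps ! k)" if "k < l" "l < length ps" for k l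
  proof
    assume "box_le (ps ! l) (ps ! k)"
    then have "ps ! l = ps ! k"
      using desc[OF that] by (auto simp: box_le_def f_def prod_eq_iff)
    then show False
      using that ps(2) by (simp add: nth_eq_iff_index_eq)
  qed
  then show ?thesis
    using ps by (auto simp: increasing_enum_def sorted_wrt_iff_nth_less)
qed

subsection \<open>Schur functions\<close>

text \<open>A partition with at most \<open>d\<close> parts is the weakly decreasing list of its \<open>d\<close> parts,
  padded with zeros.\<close>

definition conj_part :: "nat list \<Rightarrow> nat \<Rightarrow> nat" where
  "conj_part la j = card {i. i < length la \<and> la ! i \<ge> j}"

definition x_coord :: "nat \<Rightarrow> complex mat \<Rightarrow> int \<Rightarrow> complex" where
  "x_coord d u k =
     (if k = 0 then 1 else if 1 \<le> k \<and> k \<le> int d then u $$ (0, nat k) else 0)"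

text \<open>The shift \<open>i + 1\<close> turns a matrix index into the index of a part; it cancels in \<open>j - i\<close>.\<close>

definition schur_fun :: "nat \<Rightarrow> nat \<Rightarrow> nat list \<Rightarrow> complex mat \<Rightarrow> complex" where
  "schur_fun d c la u =
     det (mat c c (\<lambda>(i, j). x_coord d u (int (conj_part la (i + 1)) + int j - int i)))"

definition rect_part :: "nat \<Rightarrow> nat \<Rightarrow> nat \<Rightarrow> nat list" where
  "rect_part d m k = replicate k m @ replicate (d - k) 0"

end

theory Submission
  imports Defs
begin

text \<open>
  Write \<open>D m k = det (x\<^bsub>k + j - i\<^esub>)\<close> (\<open>m\<close> rows) for the rectangular minors. Multiplying the factors of
  the product row by row of the rectangle gives partial products whose entries are ratios of
  minors \<open>N / D\<close> of the Toeplitz matrix; that they satisfy the recurrence dictated by the factors is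
  the Desnanot--Jacobi identity, and the rank conditions defining the Bruhat closure make the
  product stop at the last column. Hence every \<open>u\<close> in the variety with all \<open>D m k \<noteq> 0\<close> factors
  with parameters \<open>D m k * D (m - 1) (k - 1) / (D (m - 1) k * D m (k - 1))\<close>, which is totally
  nonnegative if all \<open>D m k > 0\<close>. For \<open>u_pos d n t\<close> the entries of the partial products have closed forms
  in sines (hook content formula), and the recurrence becomes Ptolemy's identity for sines.
  Conversely, total nonnegativity together with \<open>x\<^sub>d \<noteq> 0\<close> forces all \<open>D m k\<close> to be nonzero, again
  by Desnanot--Jacobi; and \<open>x\<^sub>d \<noteq> 0\<close> singles out the open cell inside the variety.
\<close>

subsection \<open>Minors\<close>

text \<open>A product of \<open>d * c\<close> elementary matrices is never expanded. Within one row
  of the rectangle, taken from right to left, every column operation reads a left neighbour which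
  that row has not yet changed, so a whole row of factors acts by one two-term recurrence. A matrix
  equals the product once an explicit family \<open>P k\<close> satisfies this recurrence
  (\<open>mat_eq_box_product\<close>); the two halves of the theorem differ in the family. In (1) it
  is a guess in sines, so no minor has to be evaluated and \<open>u_pos d n t\<close> need not first
  be placed in the variety. Apart from keeping denominators nonzero, the angle pi / n matters only
  at the right edge, where sin pi = 0. The closure is exploited only through polynomial equations
  valid on the cell: zeros of the first row beyond \<open>d\<close>, and vanishing minors of size
  \<open>c + 1\<close> that contain the first \<open>c\<close> rows. Together with a nonzero corner
  these equations also give membership in the cell, by a Schur complement. Desnanot--Jacobi is
  proved by elimination and so asks for a nonzero pivot; this is why the converse works at a minimal
  zero of \<open>D\<close>.\<close>

definition minor :: "(nat \<Rightarrow> nat \<Rightarrow> 'a) \<Rightarrow> nat \<Rightarrow> (nat \<Rightarrow> nat) \<Rightarrow> (nat \<Rightarrow> nat) \<Rightarrow> 'a :: comm_ring_1"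
  where "minor f m \<rho> \<sigma> = det (mat m m (\<lambda>(i, j). f (\<rho> i) (\<sigma> j)))"

lemma minor_cong:
  assumes "\<And>i j. i < m \<Longrightarrow> j < m \<Longrightarrow> f (\<rho> i) (\<sigma> j) = f' (\<rho>' i) (\<sigma>' j)"
  shows "minor f m \<rho> \<sigma> = minor f' m \<rho>' \<sigma>'"
  unfolding minor_def by (rule arg_cong[where f = det]) (auto intro!: eq_matI simp: assms)

lemma minor_0 [simp]: "minor f 0 \<rho> \<sigma> = 1"
  by (simp add: minor_def)

lemma minor_same_rows:
  assumes "i < m" "j < m" "i \<noteq> j" "\<And>l. l < m \<Longrightarrow> f (\<rho> i) (\<sigma> l) = f (\<rho> j) (\<sigma> l)"
  shows "minor f m \<rho> \<sigma> = 0"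
  unfolding minor_def
  by (rule det_identical_rows[of _ m i j]) (use assms in \<open>auto intro!: eq_vecI\<close>)

lemma minor_same_cols:
  assumes "i < m" "j < m" "i \<noteq> j" "\<And>l. l < m \<Longrightarrow> f (\<rho> l) (\<sigma> i) = f (\<rho> l) (\<sigma> j)"
  shows "minor f m \<rho> \<sigma> = 0"
  unfolding minor_def
  by (rule det_identical_columns[of _ m i j]) (use assms in \<open>auto intro!: eq_vecI\<close>)

lemma minor_lower_triangular:
  assumes "\<And>i j. i < j \<Longrightarrow> j < m \<Longrightarrow> f (\<rho> i) (\<sigma> j) = 0"
  shows "minor f m \<rho> \<sigma> = (\<Prod>i<m. f (\<rho> i) (\<sigma> i))"
  unfolding minor_def
  by (subst det_lower_triangular[of m])
     (use assms in \<open>auto simp: prod_list_diag_prod atLeast0LessThan\<close>)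

lemma minor_upper_triangular:
  assumes "\<And>i j. j < i \<Longrightarrow> i < m \<Longrightarrow> f (\<rho> i) (\<sigma> j) = 0"
  shows "minor f m \<rho> \<sigma> = (\<Prod>i<m. f (\<rho> i) (\<sigma> i))"
  unfolding minor_def
  by (subst det_upper_triangular[of _ m])
     (use assms in \<open>auto simp: prod_list_diag_prod atLeast0LessThan intro!: upper_triangularI\<close>)

lemma minor_laplace_row:
  assumes "i \<le> m"
  shows "minor f (Suc m) \<rho> \<sigma> =
    (\<Sum>j<Suc m. f (\<rho> i) (\<sigma> j) * ((-1) ^ (i + j) * minor f m (\<rho> \<circ> insert_index i) (\<sigma> \<circ> insert_index j)))"
proof -
  have *: "mat_delete (mat (Suc m) (Suc m) (\<lambda>(i, j). f (\<rho> i) (\<sigma> j))) i j =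
      mat m m (\<lambda>(k, l). f ((\<rho> \<circ> insert_index i) k) ((\<sigma> \<circ> insert_index j) l))" if "j < Suc m" for j
    using that assms by (auto simp: mat_delete_def insert_index_def intro!: eq_matI)
  show ?thesis
    unfolding minor_def
    by (subst laplace_expansion_row[of _ "Suc m" i])
       (use assms in \<open>auto simp: cofactor_def * simp del: sum.lessThan_Suc intro!: sum.cong\<close>)
qed

lemma minor_transpose: "minor f m \<rho> \<sigma> = minor (\<lambda>i j. f j i) m \<sigma> \<rho>"
  unfolding minor_def
  by (subst det_transpose[of _ m, symmetric]) (auto intro!: arg_cong[where f = det] eq_matI)

lemma minor_laplace_col:
  assumes "j \<le> m"
  shows "minor f (Suc m) \<rho> \<sigma> =
    (\<Sum>i<Suc m. f (\<rho> i) (\<sigma> j) * ((-1) ^ (i + j) * minor f m (\<rho> \<circ> insert_index i) (\<sigma> \<circ> insert_index j)))"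
proof -
  have "minor f (Suc m) \<rho> \<sigma> = minor (\<lambda>i j. f j i) (Suc m) \<sigma> \<rho>"
    by (rule minor_transpose)
  also have "\<dots> = (\<Sum>i<Suc m. f (\<rho> i) (\<sigma> j) * ((-1) ^ (j + i) *
      minor (\<lambda>i j. f j i) m (\<sigma> \<circ> insert_index j) (\<rho> \<circ> insert_index i)))"
    by (rule minor_laplace_row[OF assms])
  also have "\<dots> = (\<Sum>i<Suc m. f (\<rho> i) (\<sigma> j) * ((-1) ^ (i + j) *
      minor f m (\<rho> \<circ> insert_index i) (\<sigma> \<circ> insert_index j)))"
    by (simp only: minor_transpose[of f m] add.commute)
  finally show ?thesis .
qed

lemma minor_last_row:
  "minor f (Suc m) \<rho> \<sigma> =
    (\<Sum>j<Suc m. f (\<rho> m) (\<sigma> j) * ((-1) ^ (m + j) * minor f m \<rho> (\<sigma> \<circ> insert_index j)))"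
  unfolding minor_laplace_row[OF order_refl]
  by (intro sum.cong refl arg_cong2[where f = "(*)"] minor_cong) (auto simp: insert_index_def)

lemma minor_last_col:
  "minor f (Suc m) \<rho> \<sigma> =
    (\<Sum>i<Suc m. f (\<rho> i) (\<sigma> m) * ((-1) ^ (i + m) * minor f m (\<rho> \<circ> insert_index i) \<sigma>))"
  unfolding minor_laplace_col[OF order_refl]
  by (intro sum.cong refl arg_cong2[where f = "(*)"] minor_cong) (auto simp: insert_index_def)

lemma minor_add_rows:
  assumes "\<And>i j. i < m \<Longrightarrow> j \<le> m \<Longrightarrow> g i j = f (\<rho> i) (\<sigma> j)"
    and "\<And>j. j \<le> m \<Longrightarrow> g m j = f (\<rho> m) (\<sigma> j) + (\<Sum>l<m. \<mu> l * f (\<rho> l) (\<sigma> j))"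
  shows "minor f (Suc m) \<rho> \<sigma> = minor g (Suc m) id id"
proof -
  define L where "L = mat (Suc m) (Suc m) (\<lambda>(i, j). if i = j then 1 else if i = m then \<mu> j else 0)"
  define G where "G = mat (Suc m) (Suc m) (\<lambda>(i, j). f (\<rho> i) (\<sigma> j))"
  have c: "L \<in> carrier_mat (Suc m) (Suc m)" "G \<in> carrier_mat (Suc m) (Suc m)"
    by (auto simp: L_def G_def)
  have detL: "det L = 1"
    by (subst det_lower_triangular[of "Suc m"])
       (auto simp: L_def prod_list_diag_prod intro!: prod.neutral)
  have "L * G = mat (Suc m) (Suc m) (\<lambda>(i, j). g i j)"
  proof (rule eq_matI)
    fix i j assume "i < dim_row (mat (Suc m) (Suc m) (\<lambda>(i, j). g i j))"
      "j < dim_col (mat (Suc m) (Suc m) (\<lambda>(i, j). g i j))"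
    then have ij: "i < Suc m" "j < Suc m" by auto
    have "(L * G) $$ (i, j) = (\<Sum>l<Suc m. L $$ (i, l) * G $$ (l, j))"
      using ij c by (simp add: scalar_prod_def atLeast0LessThan del: sum.lessThan_Suc)
    also have "\<dots> = g i j"
    proof (cases "i = m")
      case True
      have "(\<Sum>l<m. L $$ (m, l) * G $$ (l, j)) = (\<Sum>l<m. \<mu> l * f (\<rho> l) (\<sigma> j))"
        using ij by (intro sum.cong) (auto simp: L_def G_def)
      then show ?thesis using True ij assms(2)[of j] by (simp add: L_def G_def)
    next
      case False
      then have "(\<Sum>l<Suc m. L $$ (i, l) * G $$ (l, j)) = (\<Sum>l<Suc m. if l = i then f (\<rho> i) (\<sigma> j) else 0)"
        using ij by (intro sum.cong) (auto simp: L_def G_def)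
      then show ?thesis using False ij assms(1)[of i j] by simp
    qed
    finally show "(L * G) $$ (i, j) = mat (Suc m) (Suc m) (\<lambda>(i, j). g i j) $$ (i, j)"
      using ij by simp
  qed (auto simp: L_def G_def)
  then have "det L * det G = minor g (Suc m) id id"
    using det_mult[OF c] by (simp add: minor_def)
  then show ?thesis by (simp add: detL minor_def G_def)
qed

text \<open>The cofactors of the last row do not see that row, so they survive adding multiples of
  the other rows to it. With \<open>\<mu>\<close> chosen to kill most entries, the expansion
  collapses to one or two terms.\<close>

lemma minor_last_row_eliminated:
  "minor f (Suc m) \<rho> \<sigma> =
    (\<Sum>j<Suc m. (f (\<rho> m) (\<sigma> j) + (\<Sum>l<m. \<mu> l * f (\<rho> l) (\<sigma> j))) *
       ((-1) ^ (m + j) * minor f m \<rho> (\<sigma> \<circ> insert_index j)))"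
proof -
  define g where "g i j = (if i = m then f (\<rho> m) (\<sigma> j) + (\<Sum>l<m. \<mu> l * f (\<rho> l) (\<sigma> j))
    else f (\<rho> i) (\<sigma> j))" for i j
  have "minor f (Suc m) \<rho> \<sigma> = minor g (Suc m) id id"
    by (rule minor_add_rows) (auto simp: g_def)
  also have "\<dots> = (\<Sum>j<Suc m. (f (\<rho> m) (\<sigma> j) + (\<Sum>l<m. \<mu> l * f (\<rho> l) (\<sigma> j))) *
       ((-1) ^ (m + j) * minor f m \<rho> (\<sigma> \<circ> insert_index j)))"
    unfolding minor_last_row
    by (intro sum.cong refl arg_cong2[where f = "(*)"] minor_cong) (auto simp: g_def)
  finally show ?thesis .
qed

text \<open>Cramer's rule: \<open>\<mu>\<close> is \<open>v\<close> times the adjugate, divided by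
  the determinant. It supplies the multipliers for the eliminations.\<close>

lemma minor_nonzero_row_span:
  fixes f :: "nat \<Rightarrow> nat \<Rightarrow> 'a :: field"
  assumes "minor f m \<rho> \<sigma> \<noteq> 0"
  shows "\<exists>\<mu>. \<forall>j<m. v j = (\<Sum>i<m. \<mu> i * f (\<rho> i) (\<sigma> j))"
proof -
  define A where "A = mat m m (\<lambda>(i, j). f (\<rho> i) (\<sigma> j))"
  have A: "A \<in> carrier_mat m m" by (simp add: A_def)
  have d: "det A \<noteq> 0" using assms by (simp add: A_def minor_def)
  define B where "B = adj_mat A"
  have B: "B \<in> carrier_mat m m" "B * A = det A \<cdot>\<^sub>m 1\<^sub>m m"
    using adj_mat[OF A] by (auto simp: B_def)
  have BA: "(\<Sum>i<m. B $$ (l, i) * A $$ (i, j)) = (if l = j then det A else 0)" if "l < m" "j < m" for l j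
  proof -
    have "(B * A) $$ (l, j) = (\<Sum>i<m. B $$ (l, i) * A $$ (i, j))"
      using that A B(1) by (simp add: scalar_prod_def atLeast0LessThan)
    moreover have "(B * A) $$ (l, j) = (if l = j then det A else 0)"
      using that by (simp add: B(2))
    ultimately show ?thesis by simp
  qed
  define \<mu> where "\<mu> i = (\<Sum>l<m. v l * B $$ (l, i)) / det A" for i
  have "v j = (\<Sum>i<m. \<mu> i * f (\<rho> i) (\<sigma> j))" if j: "j < m" for j
  proof -
    have "(\<Sum>i<m. \<mu> i * f (\<rho> i) (\<sigma> j)) = (\<Sum>i<m. \<Sum>l<m. v l * (B $$ (l, i) * A $$ (i, j))) / det A"
      using j by (simp add: \<mu>_def A_def sum_divide_distrib sum_distrib_right mult.assoc)
    also have "(\<Sum>i<m. \<Sum>l<m. v l * (B $$ (l, i) * A $$ (i, j))) = (\<Sum>l<m. v l * (\<Sum>i<m. B $$ (l, i) * A $$ (i, j)))"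
      by (subst sum.swap) (simp add: sum_distrib_left)
    also have "\<dots> = (\<Sum>l<m. if l = j then v j * det A else 0)"
      using j by (intro sum.cong) (auto simp: BA)
    finally show ?thesis using j d by simp
  qed
  then show ?thesis by blast
qed

text \<open>Gaussian elimination: the pivot rows clear columns 1 to \<open>m\<close> of the last row
  \<open>\<gamma> (Suc m)\<close>, so each minor containing that row expands into its outer entries.
  The selection \<open>\<iota>\<close> decides which row is dropped beside the last one;
  \<open>id\<close> and \<open>Suc\<close> give the two versions applied to Toeplitz
  matrices.\<close>

lemma desnanot_jacobi:
  fixes f :: "nat \<Rightarrow> nat \<Rightarrow> 'a :: field"
  assumes \<iota>: "\<And>i. i < m \<Longrightarrow> \<iota> i \<le> m"
    and piv: "minor f m (\<gamma> \<circ> \<iota>) (\<tau> \<circ> Suc) \<noteq> 0"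
    and \<rho>: "\<And>i. i < m \<Longrightarrow> \<rho> i = \<gamma> (\<iota> i)" "\<rho> m = \<gamma> (Suc m)"
  shows "minor f (Suc (Suc m)) \<gamma> \<tau> * minor f m (\<gamma> \<circ> \<iota>) (\<tau> \<circ> Suc) =
    minor f (Suc m) \<rho> (\<tau> \<circ> Suc) * minor f (Suc m) \<gamma> \<tau> -
    minor f (Suc m) \<rho> \<tau> * minor f (Suc m) \<gamma> (\<tau> \<circ> Suc)"
proof -
  obtain \<mu> where \<mu>: "f (\<gamma> (Suc m)) (\<tau> (Suc j)) = (\<Sum>i<m. \<mu> i * f (\<gamma> (\<iota> i)) (\<tau> (Suc j)))" if "j < m" for j
    using minor_nonzero_row_span[OF piv, of "\<lambda>j. f (\<gamma> (Suc m)) (\<tau> (Suc j))"] by auto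
  define b where "b j = f (\<gamma> (Suc m)) (\<tau> j) + (\<Sum>i<m. (- \<mu> i) * f (\<gamma> (\<iota> i)) (\<tau> j))" for j
  have b0: "b j = 0" if "0 < j" "j \<le> m" for j
    using that \<mu>[of "j - 1"] by (simp add: b_def sum_negf)
  \<comment> \<open>The combination of pivot rows is rewritten over the first \<open>m + 1\<close>
    rows of \<open>\<gamma>\<close>, as the big minor requires. Summing over the fibres of
    \<open>\<iota>\<close> makes this work without injectivity.\<close>
  define \<nu> where "\<nu> l = (\<Sum>i | i < m \<and> \<iota> i = l. - \<mu> i)" for l
  have b\<nu>: "b j = f (\<gamma> (Suc m)) (\<tau> j) + (\<Sum>l<Suc m. \<nu> l * f (\<gamma> l) (\<tau> j))" for j
  proof -
    have "(\<Sum>l<Suc m. \<nu> l * f (\<gamma> l) (\<tau> j)) =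
        (\<Sum>l<Suc m. \<Sum>i\<in>{i \<in> {..<m}. \<iota> i = l}. (- \<mu> i) * f (\<gamma> (\<iota> i)) (\<tau> j))"
      unfolding \<nu>_def sum_distrib_right
      by (intro sum.cong) auto
    also have "\<dots> = (\<Sum>i<m. (- \<mu> i) * f (\<gamma> (\<iota> i)) (\<tau> j))"
      by (rule sum.group) (use \<iota> in \<open>auto simp: less_Suc_eq_le\<close>)
    finally show ?thesis by (simp add: b_def)
  qed
  define p where "p = minor f m (\<gamma> \<circ> \<iota>) (\<tau> \<circ> Suc)"
  have p: "minor f m \<rho> (\<tau> \<circ> Suc) = p"
    unfolding p_def by (rule minor_cong) (simp add: \<rho>)
  have \<rho>b: "f (\<rho> m) (\<tau> j) + (\<Sum>l<m. (- \<mu> l) * f (\<rho> l) (\<tau> j)) = b j" for j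
    by (simp add: b_def \<rho> sum_negf)
  have ins0: "\<tau> \<circ> insert_index 0 = \<tau> \<circ> Suc"
    by (auto simp: insert_index_def)
  have big: "minor f (Suc (Suc m)) \<gamma> \<tau> =
      b 0 * ((-1) ^ Suc m * minor f (Suc m) \<gamma> (\<tau> \<circ> Suc)) + b (Suc m) * minor f (Suc m) \<gamma> \<tau>"
  proof -
    have "minor f (Suc (Suc m)) \<gamma> \<tau> =
        (\<Sum>j<Suc (Suc m). b j * ((-1) ^ (Suc m + j) * minor f (Suc m) \<gamma> (\<tau> \<circ> insert_index j)))"
      unfolding minor_last_row_eliminated[of f "Suc m" \<gamma> \<tau> \<nu>] b\<nu> ..
    also have "\<dots> = (\<Sum>j\<in>{0, Suc m}. b j * ((-1) ^ (Suc m + j) * minor f (Suc m) \<gamma> (\<tau> \<circ> insert_index j)))"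
      by (rule sum.mono_neutral_right) (auto simp: b0)
    finally have "minor f (Suc (Suc m)) \<gamma> \<tau> =
        (\<Sum>j\<in>{0, Suc m}. b j * ((-1) ^ (Suc m + j) * minor f (Suc m) \<gamma> (\<tau> \<circ> insert_index j)))" .
    moreover have "minor f (Suc m) \<gamma> (\<tau> \<circ> insert_index (Suc m)) = minor f (Suc m) \<gamma> \<tau>"
      by (rule minor_cong) (simp add: insert_index_def)
    ultimately show ?thesis by (simp add: ins0)
  qed
  have r0: "minor f (Suc m) \<rho> \<tau> = b 0 * ((-1) ^ m * p)"
  proof -
    have "minor f (Suc m) \<rho> \<tau> =
        (\<Sum>j<Suc m. b j * ((-1) ^ (m + j) * minor f m \<rho> (\<tau> \<circ> insert_index j)))"
      unfolding minor_last_row_eliminated[of f m \<rho> \<tau> "\<lambda>i. - \<mu> i"] \<rho>b ..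
    also have "\<dots> = (\<Sum>j\<in>{0}. b j * ((-1) ^ (m + j) * minor f m \<rho> (\<tau> \<circ> insert_index j)))"
      by (rule sum.mono_neutral_right) (auto simp: b0)
    finally show ?thesis by (simp add: ins0 p)
  qed
  have r1: "minor f (Suc m) \<rho> (\<tau> \<circ> Suc) = b (Suc m) * p"
  proof -
    have "minor f (Suc m) \<rho> (\<tau> \<circ> Suc) =
        (\<Sum>j<Suc m. b (Suc j) * ((-1) ^ (m + j) * minor f m \<rho> (\<tau> \<circ> Suc \<circ> insert_index j)))"
      unfolding minor_last_row_eliminated[of f m \<rho> "\<tau> \<circ> Suc" "\<lambda>i. - \<mu> i"] using \<rho>b by simp
    also have "\<dots> = (\<Sum>j\<in>{m}. b (Suc j) * ((-1) ^ (m + j) * minor f m \<rho> (\<tau> \<circ> Suc \<circ> insert_index j)))"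
      by (rule sum.mono_neutral_right) (auto simp: b0)
    finally have "minor f (Suc m) \<rho> (\<tau> \<circ> Suc) =
        (\<Sum>j\<in>{m}. b (Suc j) * ((-1) ^ (m + j) * minor f m \<rho> (\<tau> \<circ> Suc \<circ> insert_index j)))" .
    moreover have "minor f m \<rho> (\<tau> \<circ> Suc \<circ> insert_index m) = p"
      unfolding p[symmetric] by (rule minor_cong) (simp add: insert_index_def)
    ultimately show ?thesis by (simp add: p)
  qed
  show ?thesis
    unfolding big r0 r1 p_def[symmetric] by (simp add: algebra_simps)
qed

subsection \<open>Ordered products over a rectangle\<close>

lemma mat_list_prod_Nil [simp]: "mat_list_prod n [] = 1\<^sub>m n"
  by (simp add: mat_list_prod_def)

lemma mat_list_prod_Cons [simp]: "mat_list_prod n (A # As) = A * mat_list_prod n As"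
  by (simp add: mat_list_prod_def)

lemma mat_list_prod_carrier [simp, intro]:
  "(\<And>A. A \<in> set As \<Longrightarrow> A \<in> carrier_mat n n) \<Longrightarrow> mat_list_prod n As \<in> carrier_mat n n"
proof (induction As)
  case (Cons A As)
  then have "A \<in> carrier_mat n n" "mat_list_prod n As \<in> carrier_mat n n" by auto
  then show ?case by simp
qed simp

lemma mat_list_prod_append:
  assumes "\<And>A. A \<in> set As \<union> set Bs \<Longrightarrow> A \<in> carrier_mat n n"
  shows "mat_list_prod n (As @ Bs) = mat_list_prod n As * mat_list_prod n Bs"
  using assms
proof (induction As)
  case Nil
  then have "mat_list_prod n Bs \<in> carrier_mat n n" by auto
  then show ?case by simp
next
  case (Cons A As)
  then have "A \<in> carrier_mat n n" "mat_list_prod n As \<in> carrier_mat n n"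
    "mat_list_prod n Bs \<in> carrier_mat n n" by auto
  then show ?case using Cons by (simp add: assoc_mult_mat[of A n n _ n _ n])
qed

lemma mat_list_prod_move_front:
  assumes "A \<in> carrier_mat n n" "\<And>B. B \<in> set Bs \<Longrightarrow> B \<in> carrier_mat n n"
    and "\<And>B. B \<in> set Bs \<Longrightarrow> A * B = B * A"
  shows "mat_list_prod n Bs * A = A * mat_list_prod n Bs"
  using assms
proof (induction Bs)
  case Nil
  then show ?case by simp
next
  case (Cons B Bs)
  define M where "M = mat_list_prod n Bs"
  have c: "A \<in> carrier_mat n n" "B \<in> carrier_mat n n" "M \<in> carrier_mat n n"
    using Cons.prems by (auto simp: M_def)
  have "B * M * A = B * (M * A)" using c by (simp add: assoc_mult_mat)
  also have "\<dots> = B * (A * M)" using Cons by (simp add: M_def)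
  also have "\<dots> = (B * A) * M" using c by (simp add: assoc_mult_mat)
  also have "\<dots> = (A * B) * M" using Cons.prems by simp
  also have "\<dots> = A * (B * M)" using c by (simp add: assoc_mult_mat)
  finally show ?case by (simp add: M_def)
qed

text \<open>The head \<open>q\<close> of the second list can be moved to the front of the first.
  Whatever precedes it there follows it in the second list, hence is incomparable to it, and the
  factors commute.\<close>

lemma linear_extension_prod_eq:
  assumes "distinct ps" "distinct qs" "set ps = set qs"
    and "sorted_wrt (\<lambda>p q. \<not> R q p) ps" "sorted_wrt (\<lambda>p q. \<not> R q p) qs"
    and "\<And>p. p \<in> set ps \<Longrightarrow> g p \<in> carrier_mat n n"
    and "\<And>p q. p \<in> set ps \<Longrightarrow> q \<in> set ps \<Longrightarrow> \<not> R p q \<Longrightarrow> \<not> R q p \<Longrightarrow> g p * g q = g q * g p"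
  shows "mat_list_prod n (map g ps) = mat_list_prod n (map g qs)"
  using assms
proof (induction qs arbitrary: ps)
  case Nil
  then show ?case by simp
next
  case (Cons q qs)
  from Cons.prems(3) obtain as bs where ps: "ps = as @ q # bs"
    by (metis list.set_intros(1) split_list)
  have s: "set (as @ bs) = set qs" "distinct (as @ bs)"
    using Cons.prems(1-3) by (auto simp: ps)
  have IH: "mat_list_prod n (map g (as @ bs)) = mat_list_prod n (map g qs)"
    by (rule Cons.IH)
       (use Cons.prems s in \<open>auto simp: ps sorted_wrt_append\<close>)
  have comm: "g q * B = B * g q" if "B \<in> set (map g as)" for B
  proof -
    from that obtain p where p: "p \<in> set as" "B = g p" by auto
    have "\<not> R q p" using Cons.prems(4) p by (auto simp: ps sorted_wrt_append)
    moreover have "p \<in> set qs" using p s by auto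
    then have "\<not> R p q" using Cons.prems(5) by auto
    ultimately show ?thesis unfolding p by (intro Cons.prems(7)) (auto simp: ps p)
  qed
  define M N where "M = mat_list_prod n (map g as)" and "N = mat_list_prod n (map g bs)"
  have gc: "g p \<in> carrier_mat n n" if "p \<in> set ps" for p using Cons.prems(6) that .
  have c: "M \<in> carrier_mat n n" "N \<in> carrier_mat n n" "g q \<in> carrier_mat n n"
    using gc unfolding M_def N_def ps by (auto intro!: mat_list_prod_carrier)
  have "mat_list_prod n (map g ps) = M * (g q * N)"
    unfolding ps using gc by (subst map_append, subst mat_list_prod_append) (auto simp: M_def N_def ps)
  also have "\<dots> = (M * g q) * N" using c by (simp add: assoc_mult_mat)
  also have "M * g q = g q * M"
    unfolding M_def by (rule mat_list_prod_move_front) (use gc comm c in \<open>auto simp: ps\<close>)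
  also have "(g q * M) * N = g q * (M * N)" using c by (simp add: assoc_mult_mat)
  also have "M * N = mat_list_prod n (map g qs)"
    unfolding IH[symmetric]
    using gc by (subst map_append, subst mat_list_prod_append) (auto simp: M_def N_def ps)
  finally show ?case by simp
qed

text \<open>The reference order: rows from \<open>i = d\<close> to \<open>i = 1\<close>, each from
  right to left. In row \<open>i = d - k\<close> the indices \<open>d - i + j\<close> descend from
  \<open>k + c\<close> to \<open>k + 1\<close>, so no column operation reads a column already
  altered in that row.\<close>

definition box_list :: "nat \<Rightarrow> nat \<Rightarrow> (nat \<times> nat) list" where
  "box_list d c = concat (map (\<lambda>k. map (\<lambda>j. (d - k, j)) (rev [1..<Suc c])) [0..<d])"

lemma sorted_wrt_concat_map:
  assumes "\<And>x. x \<in> set xs \<Longrightarrow> sorted_wrt R (f x)"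
    and "sorted_wrt (\<lambda>x y. \<forall>p\<in>set (f x). \<forall>q\<in>set (f y). R p q) xs"
  shows "sorted_wrt R (concat (map f xs))"
  using assms by (induction xs) (auto simp: sorted_wrt_append)

lemma increasing_enum_box_list: "increasing_enum d c (box_list d c)"
proof -
  \<comment> \<open>Adding \<open>p \<noteq> q\<close> to the relation yields distinctness from the
    same sortedness argument.\<close>
  have 1: "sorted_wrt (\<lambda>p q. p \<noteq> q \<and> \<not> box_le q p) (box_list d c)"
    unfolding box_list_def
  proof (rule sorted_wrt_concat_map)
    show "sorted_wrt (\<lambda>x y. \<forall>p\<in>set (map (\<lambda>j. (d - x, j)) (rev [1..<Suc c])).
        \<forall>q\<in>set (map (\<lambda>j. (d - y, j)) (rev [1..<Suc c])). p \<noteq> q \<and> \<not> box_le q p) [0..<d]"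
      by (rule sorted_wrt_mono_rel[OF _ sorted_wrt_upt]) (auto simp: box_le_def)
  next
    fix x
    show "sorted_wrt (\<lambda>p q. p \<noteq> q \<and> \<not> box_le q p) (map (\<lambda>j. (d - x, j)) (rev [1..<Suc c]))"
      unfolding sorted_wrt_map sorted_wrt_rev
      by (rule sorted_wrt_mono_rel[OF _ sorted_wrt_upt]) (auto simp: box_le_def)
  qed
  have "distinct (box_list d c)"
    using sorted_wrt_mono_rel[OF _ 1, of "(\<noteq>)"] by (auto simp: distinct_conv_nth sorted_wrt_iff_nth_less)
       (metis linorder_neqE_nat)
  moreover have "sorted_wrt (\<lambda>p q. \<not> box_le q p) (box_list d c)"
    by (rule sorted_wrt_mono_rel[OF _ 1]) auto
  moreover have "set (box_list d c) = boxes d c"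
  proof -
    have "(i, j) \<in> set (box_list d c) \<longleftrightarrow> (i, j) \<in> boxes d c" for i j
    proof
      assume "(i, j) \<in> boxes d c"
      then have "d - i < d" "(i, j) \<in> set (map (\<lambda>j. (d - (d - i), j)) (rev [1..<Suc c]))"
        by (auto simp: boxes_def)
      then show "(i, j) \<in> set (box_list d c)"
        unfolding box_list_def set_concat set_map[of _ "[0..<d]"] by force
    qed (auto simp: box_list_def boxes_def)
    then show ?thesis by auto
  qed
  ultimately show ?thesis by (simp add: increasing_enum_def)
qed

text \<open>Incomparable boxes differ in opposite directions in \<open>i\<close> and
  \<open>j\<close>, so their indices \<open>d - i + j\<close> are at least 2 apart. The family
  \<open>g\<close> is abstract to serve both \<open>x_mat\<close> and \<open>s_mat\<close>.\<close>

lemma increasing_enum_prod_eq: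
  assumes "increasing_enum d c ps" "increasing_enum d c qs"
    and "\<And>l a. g l a \<in> carrier_mat n n"
    and "\<And>l l' a a'. 1 \<le> l \<Longrightarrow> l + 2 \<le> l' \<Longrightarrow> l' < d + c \<Longrightarrow> g l a * g l' a' = g l' a' * g l a"
  shows "mat_list_prod n (map (\<lambda>(i, j). g (d - i + j) (v i j)) ps) =
         mat_list_prod n (map (\<lambda>(i, j). g (d - i + j) (v i j)) qs)"
proof (rule linear_extension_prod_eq[where R = box_le])
  fix p q assume pq: "p \<in> set ps" "q \<in> set ps" "\<not> box_le p q" "\<not> box_le q p"
  obtain i j i' j' where e: "p = (i, j)" "q = (i', j')" by (cases p, cases q)
  have *: "1 \<le> i" "i \<le> d" "1 \<le> j" "j \<le> c" "1 \<le> i'" "i' \<le> d" "1 \<le> j'" "j' \<le> c" using pq assms(1) e by (auto simp: increasing_enum_def boxes_def)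
  with pq have "d - i + j + 2 \<le> d - i' + j' \<or> d - i' + j' + 2 \<le> d - i + j"
    by (auto simp: e box_le_def)
  then show "(case p of (i, j) \<Rightarrow> g (d - i + j) (v i j)) * (case q of (i, j) \<Rightarrow> g (d - i + j) (v i j)) =
    (case q of (i, j) \<Rightarrow> g (d - i + j) (v i j)) * (case p of (i, j) \<Rightarrow> g (d - i + j) (v i j))"
    using assms(4)[of "d - i + j" "d - i' + j'" "v i j" "v i' j'"]
      assms(4)[of "d - i' + j'" "d - i + j" "v i' j'" "v i j"] * by (auto simp: e)
qed (use assms in \<open>auto simp: increasing_enum_def\<close>)

section \<open>One-parameter subgroups as column operations\<close>

lemma mult_x_mat:
  assumes "A \<in> carrier_mat n n" "1 \<le> l" "l < n"
  shows "A * x_mat n l a = mat n n (\<lambda>(r, s). A $$ (r, s) + (if s = l then a * A $$ (r, l - 1) else 0))"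
proof (rule eq_matI)
  fix r s assume "r < dim_row (mat n n (\<lambda>(r, s). A $$ (r, s) + (if s = l then a * A $$ (r, l - 1) else 0)))"
    "s < dim_col (mat n n (\<lambda>(r, s). A $$ (r, s) + (if s = l then a * A $$ (r, l - 1) else 0)))"
  then have rs: "r < n" "s < n" by auto
  have "(A * x_mat n l a) $$ (r, s) = (\<Sum>k<n. A $$ (r, k) * x_mat n l a $$ (k, s))"
    using assms rs by (simp add: scalar_prod_def atLeast0LessThan x_mat_def e_mat_def)
  also have "\<dots> = (\<Sum>k<n. (if k = s then A $$ (r, s) else 0) +
      (if k = l - 1 then if s = l then a * A $$ (r, l - 1) else 0 else 0))"
    using assms rs by (intro sum.cong) (auto simp: x_mat_def e_mat_def algebra_simps)
  also have "\<dots> = A $$ (r, s) + (if s = l then a * A $$ (r, l - 1) else 0)"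
    using assms rs by (auto simp: sum.distrib)
  finally show "(A * x_mat n l a) $$ (r, s) =
    mat n n (\<lambda>(r, s). A $$ (r, s) + (if s = l then a * A $$ (r, l - 1) else 0)) $$ (r, s)"
    using rs by simp
qed (use assms in \<open>auto simp: x_mat_def e_mat_def\<close>)

lemma x_mat_carrier [simp]: "x_mat n l a \<in> carrier_mat n n"
  by (simp add: x_mat_def e_mat_def)

lemma e_mat_carrier [simp]: "e_mat n l \<in> carrier_mat n n"
  by (simp add: e_mat_def)

lemma e_mat_mult_0:
  assumes "l' \<noteq> Suc l"
  shows "e_mat n l * e_mat n l' = 0\<^sub>m n n"
proof (rule eq_matI)
  fix i j assume "i < dim_row (0\<^sub>m n n :: complex mat)" "j < dim_col (0\<^sub>m n n :: complex mat)"
  then show "(e_mat n l * e_mat n l') $$ (i, j) = 0\<^sub>m n n $$ (i, j)"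
    using assms by (auto simp: e_mat_def scalar_prod_def intro!: sum.neutral)
qed (auto simp: e_mat_def)

lemma x_mat_commute:
  assumes "l + 2 \<le> l'"
  shows "x_mat n l a * x_mat n l' b = x_mat n l' b * x_mat n l a"
proof -
  have z: "(a \<cdot>\<^sub>m e_mat n l) * (b \<cdot>\<^sub>m e_mat n l') = 0\<^sub>m n n"
    "(b \<cdot>\<^sub>m e_mat n l') * (a \<cdot>\<^sub>m e_mat n l) = 0\<^sub>m n n"
    using assms by (auto simp: e_mat_mult_0 mult_smult_assoc_mat[of _ n n _ n] mult_smult_distrib[of _ n n _ n])
  define E F where "E = a \<cdot>\<^sub>m e_mat n l" and "F = b \<cdot>\<^sub>m e_mat n l'"
  have c: "E \<in> carrier_mat n n" "F \<in> carrier_mat n n" by (auto simp: E_def F_def)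
  have "(1\<^sub>m n + E) * (1\<^sub>m n + F) = (1\<^sub>m n + F) * (1\<^sub>m n + E)"
    using c z by (simp add: E_def[symmetric] F_def[symmetric] add_mult_distrib_mat[of _ n n _ _ n]
      mult_add_distrib_mat[of _ n n _ n] add_carrier_mat comm_add_mat assoc_add_mat)
       (simp add: comm_add_mat[of E n n F] assoc_add_mat[of _ n n])
  then show ?thesis by (simp add: x_mat_def E_def F_def)
qed

text \<open>The columns of \<open>P k\<close> arise from those of \<open>P (k - 1)\<close> by the column operations of the
  factors in row \<open>d + 1 - k\<close> of the rectangle.\<close>

lemma mat_eq_box_product:
  fixes P :: "nat \<Rightarrow> nat \<Rightarrow> nat \<Rightarrow> complex"
  assumes n: "n = d + c" and enum: "increasing_enum d c ps"
    and P0: "\<And>r s. r < n \<Longrightarrow> s < n \<Longrightarrow> P 0 r s = (if r = s then 1 else 0)"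
    and Pk: "\<And>k r s. k < d \<Longrightarrow> r < n \<Longrightarrow> s < n \<Longrightarrow>
      P (Suc k) r s = P k r s + (if Suc k \<le> s \<and> s \<le> k + c then a (Suc k) (s - k) * P k r (s - 1) else 0)"
  shows "mat n n (\<lambda>(r, s). P d r s) =
    mat_list_prod n (map (\<lambda>(i, j). x_mat n (d - i + j) (a (Suc d - i) j)) ps)"
proof -
  define g where "g = (\<lambda>(i, j). x_mat n (d - i + j) (a (Suc d - i) j))"
  have gc: "g p \<in> carrier_mat n n" for p by (auto simp: g_def split: prod.splits)
  \<comment> \<open>Invariant after the factors \<open>j = c, ..., c - q + 1\<close>: the columns
    from \<open>k + c - q + 1\<close> to \<open>k + c\<close> have passed from \<open>P k\<close> to
    \<open>P (Suc k)\<close>, all others are unchanged.\<close>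
  have row: "mat n n (\<lambda>(r, s). P k r s) *
      mat_list_prod n (map (\<lambda>j. g (d - k, j)) (rev [Suc c - q..<Suc c])) =
      mat n n (\<lambda>(r, s). if Suc k + c - q \<le> s \<and> s \<le> k + c then P (Suc k) r s else P k r s)"
    if "k < d" "q \<le> c" for k q
    using that(2)
  proof (induction q)
    case 0
    then show ?case by simp (auto intro!: eq_matI)
  next
    case (Suc q)
    define L where "L = map (\<lambda>j. g (d - k, j)) (rev [Suc c - q..<Suc c])"
    have cL: "mat_list_prod n L \<in> carrier_mat n n"
      unfolding L_def by (rule mat_list_prod_carrier) (use gc in auto)
    have "[Suc c - Suc q..<Suc c] = (c - q) # [Suc c - q..<Suc c]"
      using Suc.prems by (subst upt_conv_Cons) (auto simp: Suc_diff_le)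
    then have "map (\<lambda>j. g (d - k, j)) (rev [Suc c - Suc q..<Suc c]) = L @ [g (d - k, c - q)]"
      by (simp only: rev.simps map_append list.map L_def)
    moreover have "mat_list_prod n (L @ [g (d - k, c - q)]) = mat_list_prod n L * g (d - k, c - q)"
      using gc by (subst mat_list_prod_append) (auto simp: L_def right_mult_one_mat[of _ n n] simp del: upt_Suc)
    ultimately have "mat n n (\<lambda>(r, s). P k r s) *
      mat_list_prod n (map (\<lambda>j. g (d - k, j)) (rev [Suc c - Suc q..<Suc c])) =
      (mat n n (\<lambda>(r, s). P k r s) * mat_list_prod n L) * g (d - k, c - q)"
      using assoc_mult_mat[OF _ cL gc, of "mat n n (\<lambda>(r, s). P k r s)" n "(d - k, c - q)"] by simp
    also have "\<dots> = mat n n (\<lambda>(r, s). if Suc k + c - q \<le> s \<and> s \<le> k + c then P (Suc k) r s else P k r s)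
      * x_mat n (k + (c - q)) (a (Suc k) (c - q))"
      using Suc that by (simp add: L_def g_def Suc_diff_le del: upt_Suc)
    also have "\<dots> = mat n n (\<lambda>(r, s). if Suc k + c - Suc q \<le> s \<and> s \<le> k + c then P (Suc k) r s else P k r s)"
      using Suc.prems that n
      by (subst mult_x_mat) (auto intro!: eq_matI simp: Pk Suc_diff_le)
    finally show ?case .
  qed
  have row': "mat n n (\<lambda>(r, s). P k r s) *
      mat_list_prod n (map g (map (\<lambda>j. (d - k, j)) (rev [1..<Suc c]))) = mat n n (\<lambda>(r, s). P (Suc k) r s)"
    if "k < d" for k
  proof -
    have "mat n n (\<lambda>(r, s). if Suc k + c - c \<le> s \<and> s \<le> k + c then P (Suc k) r s else P k r s) =
      mat n n (\<lambda>(r, s). P (Suc k) r s)"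
      using that by (auto intro!: eq_matI simp: Pk)
    then show ?thesis using row[OF that order_refl] by (simp add: comp_def del: upt_Suc)
  qed
  have "mat_list_prod n (map g (concat (map (\<lambda>k. map (\<lambda>j. (d - k, j)) (rev [1..<Suc c])) [0..<q]))) =
    mat n n (\<lambda>(r, s). P q r s)" if "q \<le> d" for q
    using that
  proof (induction q)
    case 0
    then show ?case by (auto intro!: eq_matI simp: P0)
  next
    case (Suc q)
    then show ?case using row'[of q] gc
      by (simp del: upt_Suc add: upt_Suc_append) (subst mat_list_prod_append, auto simp del: upt_Suc)
  qed
  then have "mat_list_prod n (map g (box_list d c)) = mat n n (\<lambda>(r, s). P d r s)"
    by (simp add: box_list_def)
  moreover have "mat_list_prod n (map g ps) = mat_list_prod n (map g (box_list d c))"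
    unfolding g_def
    by (rule increasing_enum_prod_eq[OF enum increasing_enum_box_list])
       (auto intro: x_mat_commute)
  ultimately show ?thesis by (simp add: g_def)
qed

subsection \<open>Inversions and reduced words\<close>

definition perm_mat :: "nat \<Rightarrow> (nat \<Rightarrow> nat) \<Rightarrow> complex mat" where
  "perm_mat n \<pi> = mat n n (\<lambda>(i, j). if i = \<pi> j then 1 else 0)"

definition swp :: "nat \<Rightarrow> nat \<Rightarrow> nat" where
  "swp k j = (if j = k - 1 then k else if j = k then k - 1 else j)"

lemma swp_swp [simp]: "swp k (swp k j) = j"
  by (auto simp: swp_def)

lemma inj_swp: "inj (swp k)"
  by (metis injI swp_swp)

lemma perm_mat_carrier [simp]: "perm_mat n \<pi> \<in> carrier_mat n n"
  by (simp add: perm_mat_def)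

lemma perm_mat_cong: "(\<And>j. j < n \<Longrightarrow> \<pi> j = \<sigma> j) \<Longrightarrow> perm_mat n \<pi> = perm_mat n \<sigma>"
  by (auto simp: perm_mat_def intro!: eq_matI)

lemma perm_mat_eqD:
  assumes "perm_mat n \<pi> = perm_mat n \<sigma>" "j < n" "\<pi> j < n"
  shows "\<pi> j = \<sigma> j"
proof -
  have "perm_mat n \<pi> $$ (\<pi> j, j) = perm_mat n \<sigma> $$ (\<pi> j, j)" using assms by simp
  then show ?thesis using assms by (simp add: perm_mat_def split: if_splits)
qed

lemma perm_mat_mult:
  assumes "\<And>j. j < n \<Longrightarrow> \<sigma> j < n"
  shows "perm_mat n \<pi> * perm_mat n \<sigma> = perm_mat n (\<pi> \<circ> \<sigma>)"
proof (rule eq_matI)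
  fix i j assume "i < dim_row (perm_mat n (\<pi> \<circ> \<sigma>))" "j < dim_col (perm_mat n (\<pi> \<circ> \<sigma>))"
  then have ij: "i < n" "j < n" by (auto simp: perm_mat_def)
  have "(perm_mat n \<pi> * perm_mat n \<sigma>) $$ (i, j) = (\<Sum>k<n. perm_mat n \<pi> $$ (i, k) * perm_mat n \<sigma> $$ (k, j))"
    using ij by (simp add: scalar_prod_def atLeast0LessThan perm_mat_def)
  also have "\<dots> = (\<Sum>k<n. if k = \<sigma> j then if i = \<pi> k then 1 else 0 else 0)"
    using ij by (intro sum.cong) (auto simp: perm_mat_def)
  also have "\<dots> = perm_mat n (\<pi> \<circ> \<sigma>) $$ (i, j)"
    using ij assms[of j] by (simp add: perm_mat_def)
  finally show "(perm_mat n \<pi> * perm_mat n \<sigma>) $$ (i, j) = perm_mat n (\<pi> \<circ> \<sigma>) $$ (i, j)" .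
qed (auto simp: perm_mat_def)

lemma perm_mat_id: "perm_mat n id = 1\<^sub>m n"
  by (auto simp: perm_mat_def intro!: eq_matI)

lemma s_mat_eq_perm_mat: "s_mat n k = perm_mat n (swp k)"
proof -
  have "(k - 1 = i \<and> k = j \<or> k - 1 = j \<and> k = i \<or> i = j \<and> i \<noteq> k - 1 \<and> i \<noteq> k) \<longleftrightarrow> i = swp k j" for i j
    by (cases k) (auto simp: swp_def)
  then show ?thesis
    unfolding s_mat_def perm_mat_def swaprows_mat_def by presburger
qed

lemma swp_less: "k < n \<Longrightarrow> j < n \<Longrightarrow> swp k j < n"
  by (auto simp: swp_def)

lemma s_mat_carrier [simp]: "s_mat n k \<in> carrier_mat n n"
  by (simp add: s_mat_def)

lemma s_mat_commute:
  assumes "1 \<le> l" "l + 2 \<le> l'" "l' < n"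
  shows "s_mat n l * s_mat n l' = s_mat n l' * s_mat n l"
proof -
  obtain a b where ab: "l = Suc a" "l' = Suc b" "a + 2 \<le> b"
    using assms by (cases l; cases l') auto
  have "swp l \<circ> swp l' = swp l' \<circ> swp l"
    unfolding ab(1,2) fun_eq_iff swp_def comp_def diff_Suc_1 using ab(3) by simp
  then show ?thesis
    unfolding s_mat_eq_perm_mat using assms by (simp add: perm_mat_mult swp_less)
qed

lemma s_word_Nil [simp]: "s_word n [] = 1\<^sub>m n"
  by (simp add: s_word_def)

lemma s_word_snoc: "s_word n (ks @ [k]) = s_word n ks * s_mat n k"
proof -
  have "mat_list_prod n (map (s_mat n) ks) \<in> carrier_mat n n"
    by (rule mat_list_prod_carrier) auto
  then show ?thesis
    unfolding s_word_def map_append by (subst mat_list_prod_append) (auto simp: right_mult_one_mat[of _ n n])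
qed

section \<open>Length as the number of inversions\<close>

definition inversions :: "nat \<Rightarrow> (nat \<Rightarrow> nat) \<Rightarrow> (nat \<times> nat) set" where
  "inversions n \<pi> = {(i, j). i < j \<and> j < n \<and> \<pi> j < \<pi> i}"

lemma finite_inversions [simp]: "finite (inversions n \<pi>)"
  by (rule finite_subset[of _ "{..<n} \<times> {..<n}"]) (auto simp: inversions_def)

lemma inversions_cong: "(\<And>j. j < n \<Longrightarrow> \<pi> j = \<sigma> j) \<Longrightarrow> inversions n \<pi> = inversions n \<sigma>"
  by (auto simp: inversions_def)

lemma swp_strict_mono:
  assumes "i < j" "1 \<le> k" "(i, j) \<noteq> (k - 1, k)"
  shows "swp k i < swp k j"
  using assms by (auto simp: swp_def)

lemma map_swp_inj: "inj (map_prod (swp k) (swp k))"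
  by (intro prod.inj_map inj_swp)

text \<open>Right multiplication by a simple reflection relabels positions by \<open>swp k\<close>.
  This keeps the order of every pair except \<open>(k - 1, k)\<close>, the only possible new
  inversion.\<close>

lemma card_inversions_swp_le:
  assumes "1 \<le> k" "k < n"
  shows "card (inversions n (\<pi> \<circ> swp k)) \<le> Suc (card (inversions n \<pi>))"
proof -
  have "inversions n (\<pi> \<circ> swp k) \<subseteq> insert (k - 1, k) (map_prod (swp k) (swp k) ` inversions n \<pi>)"
  proof (rule subsetI)
    fix p assume p: "p \<in> inversions n (\<pi> \<circ> swp k)"
    obtain i j where ij: "p = (i, j)" "i < j" "j < n" "\<pi> (swp k j) < \<pi> (swp k i)"
      using p by (auto simp: inversions_def)
    show "p \<in> insert (k - 1, k) (map_prod (swp k) (swp k) ` inversions n \<pi>)"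
    proof (cases "p = (k - 1, k)")
      case False
      then have "(swp k i, swp k j) \<in> inversions n \<pi>"
        using ij assms swp_strict_mono[of i j k] swp_less[of k n j] by (auto simp: inversions_def)
      then have "map_prod (swp k) (swp k) (swp k i, swp k j) \<in> map_prod (swp k) (swp k) ` inversions n \<pi>"
        by blast
      then show ?thesis by (simp add: ij)
    qed simp
  qed
  then have "card (inversions n (\<pi> \<circ> swp k)) \<le> card (insert (k - 1, k) (map_prod (swp k) (swp k) ` inversions n \<pi>))"
    by (intro card_mono) auto
  also have "\<dots> \<le> Suc (card (map_prod (swp k) (swp k) ` inversions n \<pi>))"
    by (rule card_insert_le_m1) simp_all
  also have "\<dots> \<le> Suc (card (inversions n \<pi>))"
    by (simp add: card_image_le)
  finally show ?thesis .
qed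

text \<open>At a descent the relabelling embeds the new inversions into the old ones and misses
  \<open>(k - 1, k)\<close>.\<close>

lemma card_inversions_swp_less:
  assumes "1 \<le> k" "k < n" "\<pi> k < \<pi> (k - 1)"
  shows "card (inversions n (\<pi> \<circ> swp k)) < card (inversions n \<pi>)"
proof -
  have "map_prod (swp k) (swp k) ` inversions n (\<pi> \<circ> swp k) \<subseteq> inversions n \<pi> - {(k - 1, k)}"
  proof (rule image_subsetI)
    fix p assume p: "p \<in> inversions n (\<pi> \<circ> swp k)"
    obtain i j where ij: "p = (i, j)" "i < j" "j < n" "\<pi> (swp k j) < \<pi> (swp k i)"
      using p by (auto simp: inversions_def)
    have ne: "(i, j) \<noteq> (k - 1, k)"
    proof
      assume "(i, j) = (k - 1, k)"
      moreover have "swp k k = k - 1" "swp k (k - 1) = k" by (auto simp: swp_def)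
      ultimately show False using ij assms by simp
    qed
    then have "swp k i < swp k j" using ij assms swp_strict_mono by blast
    moreover have "(swp k i, swp k j) \<noteq> (k - 1, k)"
      using ij(2) assms(1) by (auto simp: swp_def split: if_splits)
    ultimately show "map_prod (swp k) (swp k) p \<in> inversions n \<pi> - {(k - 1, k)}"
      using ij assms swp_less[of k n j] by (auto simp: inversions_def)
  qed
  then have "card (map_prod (swp k) (swp k) ` inversions n (\<pi> \<circ> swp k)) \<le> card (inversions n \<pi> - {(k - 1, k)})"
    by (intro card_mono) auto
  moreover have "(k - 1, k) \<in> inversions n \<pi>"
    using assms by (auto simp: inversions_def)
  then have "card (inversions n \<pi> - {(k - 1, k)}) < card (inversions n \<pi>)"
    by (intro card_Diff1_less) auto
  moreover have "card (map_prod (swp k) (swp k) ` inversions n (\<pi> \<circ> swp k)) = card (inversions n (\<pi> \<circ> swp k))"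
    by (intro card_image inj_on_subset[OF map_swp_inj]) auto
  ultimately show ?thesis by simp
qed

text \<open>A value is the number of smaller values, and the inversion set decides for every other
  position whether its value is smaller. Hence the inversions determine the permutation, so a proper
  inclusion of inversion sets can be told from equality.\<close>

lemma permutation_rank:
  assumes "\<pi> permutes {..<n}" "j < n"
  shows "\<pi> j = card ({i. i < j \<and> (i, j) \<notin> inversions n \<pi>} \<union> {i. (j, i) \<in> inversions n \<pi>})"
proof -
  have inj: "inj \<pi>" and lt: "\<And>i. i < n \<Longrightarrow> \<pi> i < n"
    using assms(1) permutes_inj permutes_in_image by fastforce+
  have "{i. i < j \<and> (i, j) \<notin> inversions n \<pi>} \<union> {i. (j, i) \<in> inversions n \<pi>} = {i. i < n \<and> \<pi> i < \<pi> j}"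
  proof -
    have "(i < j \<and> (i, j) \<notin> inversions n \<pi> \<or> (j, i) \<in> inversions n \<pi>) \<longleftrightarrow> i < n \<and> \<pi> i < \<pi> j" for i
    proof -
      have "\<pi> i < \<pi> j \<or> \<pi> j < \<pi> i" if "i \<noteq> j"
        using that injD[OF inj, of i j] by (meson linorder_neqE_nat)
      then show ?thesis using assms(2)
        by (cases i j rule: linorder_cases) (auto simp: inversions_def)
    qed
    then show ?thesis by blast
  qed
  moreover have "\<pi> ` {i. i < n \<and> \<pi> i < \<pi> j} = {..<\<pi> j}"
  proof
    show "{..<\<pi> j} \<subseteq> \<pi> ` {i. i < n \<and> \<pi> i < \<pi> j}"
    proof
      fix y assume y: "y \<in> {..<\<pi> j}"
      then have "y \<in> \<pi> ` {..<n}" using lt[OF assms(2)] permutes_image[OF assms(1)] by auto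
      then show "y \<in> \<pi> ` {i. i < n \<and> \<pi> i < \<pi> j}" using y by auto
    qed
  qed auto
  then have "card {i. i < n \<and> \<pi> i < \<pi> j} = \<pi> j"
    by (metis card_image card_lessThan inj inj_on_subset subset_UNIV)
  ultimately show ?thesis by simp
qed

lemma perm_mat_eq_if_inversions_eq:
  assumes "\<pi> permutes {..<n}" "\<sigma> permutes {..<n}" "inversions n \<pi> = inversions n \<sigma>"
  shows "perm_mat n \<pi> = perm_mat n \<sigma>"
  by (rule perm_mat_cong) (simp add: permutation_rank[OF assms(1)] permutation_rank[OF assms(2)] assms(3))

lemma swp_permutes: "1 \<le> k \<Longrightarrow> k < n \<Longrightarrow> swp k permutes {..<n}"
  by (rule bij_imp_permutes, rule bij_betwI[where g = "swp k"]) (auto simp: swp_less, auto simp: swp_def)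

text \<open>Each letter creates at most one inversion, and a letter other than \<open>d\<close> maps
  the positions below \<open>d\<close> to themselves. The second fact identifies the elements of the
  parabolic subgroup.\<close>

lemma s_word_perm_mat:
  assumes "set ks \<subseteq> {1..n - 1}"
  shows "\<exists>\<pi>. \<pi> permutes {..<n} \<and> s_word n ks = perm_mat n \<pi> \<and> card (inversions n \<pi>) \<le> length ks \<and>
    (d \<notin> set ks \<longrightarrow> (\<forall>j<n. \<pi> j < d \<longleftrightarrow> j < d))"
  using assms
proof (induction ks rule: rev_induct)
  case Nil
  have "inversions n id = {}" by (auto simp: inversions_def)
  then have "id permutes {..<n} \<and> s_word n [] = perm_mat n id \<and> card (inversions n id) \<le> length ([] :: nat list) \<and>
    (d \<notin> set [] \<longrightarrow> (\<forall>j<n. id j < d \<longleftrightarrow> j < d))"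
    unfolding perm_mat_id by (simp add: permutes_id del: id_apply) simp
  then show ?case by blast
next
  case (snoc k ks)
  then obtain \<pi> where \<pi>: "\<pi> permutes {..<n}" "s_word n ks = perm_mat n \<pi>"
    "card (inversions n \<pi>) \<le> length ks" "d \<notin> set ks \<longrightarrow> (\<forall>j<n. \<pi> j < d \<longleftrightarrow> j < d)" by auto
  have k: "1 \<le> k" "k < n" using snoc.prems by auto
  have "s_word n (ks @ [k]) = perm_mat n (\<pi> \<circ> swp k)"
    using k by (simp add: s_word_snoc \<pi>(2) s_mat_eq_perm_mat perm_mat_mult swp_less)
  moreover have "\<pi> \<circ> swp k permutes {..<n}"
    using permutes_compose[OF swp_permutes[OF k] \<pi>(1)] .
  moreover have "card (inversions n (\<pi> \<circ> swp k)) \<le> length (ks @ [k])"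
    using card_inversions_swp_le[OF k, of \<pi>] \<pi>(3) by simp
  moreover have "\<forall>j<n. (\<pi> \<circ> swp k) j < d \<longleftrightarrow> j < d" if "d \<notin> set (ks @ [k])"
  proof (intro allI impI)
    fix j assume "j < n"
    then have "\<pi> (swp k j) < d \<longleftrightarrow> swp k j < d" using \<pi>(4) that swp_less[OF k(2)] by simp
    also have "\<dots> \<longleftrightarrow> j < d" using that k by (auto simp: swp_def)
    finally show "(\<pi> \<circ> swp k) j < d \<longleftrightarrow> j < d" by simp
  qed
  ultimately show ?case by blast
qed

text \<open>Bubble sort. No descent occurs at \<open>d\<close>, because positions below
  \<open>d\<close> carry values below \<open>d\<close> and the others do not; so the sorting word
  avoids \<open>d\<close>, and every letter removes an inversion.\<close>

lemma perm_mat_s_word: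
  assumes "\<pi> permutes {..<n}" "\<forall>j<n. \<pi> j < d \<longleftrightarrow> j < d"
  shows "\<exists>ks. set ks \<subseteq> hat n d \<and> s_word n ks = perm_mat n \<pi> \<and> length ks \<le> card (inversions n \<pi>)"
  using assms
proof (induction "card (inversions n \<pi>)" arbitrary: \<pi> rule: less_induct)
  case less
  show ?case
  proof (cases "inversions n \<pi> = {}")
    case True
    moreover have "inversions n id = {}" by (auto simp: inversions_def)
    ultimately have "perm_mat n \<pi> = 1\<^sub>m n"
      unfolding perm_mat_id[symmetric]
      by (intro perm_mat_eq_if_inversions_eq less.prems permutes_id) simp
    then show ?thesis by (intro exI[of _ "[]"]) auto
  next
    case False
    have "\<exists>k. 1 \<le> k \<and> k < n \<and> \<pi> k < \<pi> (k - 1)"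
    proof (rule ccontr)
      assume "\<not> ?thesis"
      then have step: "\<pi> k \<le> \<pi> (Suc k)" if "Suc k < n" for k
        using that by (metis One_nat_def diff_Suc_1 le_add1 linorder_not_less plus_1_eq_Suc)
      have mono: "\<pi> i \<le> \<pi> j" if "i \<le> j" "j < n" for i j
        using that by (induction j rule: dec_induct) (auto intro: order_trans step)
      have "(i, j) \<notin> inversions n \<pi>" for i j
        using mono[of i j] by (auto simp: inversions_def)
      then have "inversions n \<pi> = {}" by auto
      with False show False by simp
    qed
    then obtain k where k: "1 \<le> k" "k < n" "\<pi> k < \<pi> (k - 1)" by blast
    have kd: "k \<noteq> d"
    proof
      assume "k = d"
      then have "\<pi> (k - 1) < d" "\<not> \<pi> k < d" using less.prems(2) k by auto
      then show False using k by simp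
    qed
    have pr: "\<forall>j<n. (\<pi> \<circ> swp k) j < d \<longleftrightarrow> j < d"
    proof (intro allI impI)
      fix j assume "j < n"
      then have "\<pi> (swp k j) < d \<longleftrightarrow> swp k j < d" using less.prems(2) swp_less[OF k(2)] by simp
      also have "\<dots> \<longleftrightarrow> j < d" using kd k by (auto simp: swp_def)
      finally show "(\<pi> \<circ> swp k) j < d \<longleftrightarrow> j < d" by simp
    qed
    have lt: "card (inversions n (\<pi> \<circ> swp k)) < card (inversions n \<pi>)"
      by (rule card_inversions_swp_less[OF k])
    from less.hyps[OF lt permutes_compose[OF swp_permutes[OF k(1,2)] less.prems(1)] pr]
    obtain ks where ks: "set ks \<subseteq> hat n d" "s_word n ks = perm_mat n (\<pi> \<circ> swp k)"
      "length ks \<le> card (inversions n (\<pi> \<circ> swp k))" by blast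
    have "s_word n (ks @ [k]) = perm_mat n (\<pi> \<circ> swp k \<circ> swp k)"
      using k by (simp only: s_word_snoc ks(2) s_mat_eq_perm_mat) (simp add: perm_mat_mult swp_less)
    also have "\<pi> \<circ> swp k \<circ> swp k = \<pi>" by (simp add: fun_eq_iff)
    finally show ?thesis
      using ks lt k kd by (intro exI[of _ "ks @ [k]"]) (auto simp: hat_def)
  qed
qed

lemma weyl_length_le: "set ks \<subseteq> {1..n - 1} \<Longrightarrow> weyl_length n (s_word n ks) \<le> length ks"
  unfolding weyl_length_def by (rule Least_le) auto

text \<open>The word \<open>ks\<close> guarantees that the \<open>LEAST\<close> in
  \<open>weyl_length\<close> is attained; the bound then comes from a shortest word.\<close>

lemma weyl_length_ge:
  assumes "\<pi> permutes {..<n}" "set ks \<subseteq> {1..n - 1}" "s_word n ks = perm_mat n \<pi>"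
  shows "card (inversions n \<pi>) \<le> weyl_length n (perm_mat n \<pi>)"
proof -
  have "\<exists>ks'. set ks' \<subseteq> {1..n - 1} \<and> s_word n ks' = perm_mat n \<pi> \<and> length ks' = weyl_length n (perm_mat n \<pi>)"
    unfolding weyl_length_def by (rule LeastI[of _ "length ks"]) (use assms in auto)
  then obtain ks' where ks': "set ks' \<subseteq> {1..n - 1}" "s_word n ks' = perm_mat n \<pi>"
    "length ks' = weyl_length n (perm_mat n \<pi>)" by blast
  from s_word_perm_mat[OF ks'(1)] obtain \<sigma> where \<sigma>: "s_word n ks' = perm_mat n \<sigma>"
    "card (inversions n \<sigma>) \<le> length ks'" by blast
  have "\<pi> j = \<sigma> j" if "j < n" for j
    using perm_mat_eqD[of n \<pi> \<sigma> j] \<sigma> ks' that permutes_in_image[OF assms(1), of j] by auto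
  then have "inversions n \<pi> = inversions n \<sigma>" by (rule inversions_cong)
  then show ?thesis using \<sigma> ks' by simp
qed

section \<open>The permutation w^{hat d} and its reduced words\<close>

definition block_reversal :: "nat \<Rightarrow> nat \<Rightarrow> nat \<Rightarrow> nat" where
  "block_reversal n d j = (if j < d then d - 1 - j else if j < n then n - 1 - (j - d) else j)"

lemma block_reversal_permutes:
  assumes "d \<le> n"
  shows "block_reversal n d permutes {..<n}"
proof (rule bij_imp_permutes)
  show "bij_betw (block_reversal n d) {..<n} {..<n}"
    by (rule bij_betwI[where g = "block_reversal n d"])
       (use assms in \<open>auto simp: block_reversal_def split: if_splits\<close>)
qed (use assms in \<open>auto simp: block_reversal_def\<close>)

text \<open>Elements of the parabolic subgroup invert only pairs inside a block, and the block
  reversal inverts all of those. The inclusion is proper for every other element, which gives the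
  existence and uniqueness demanded by \<open>THE\<close>.\<close>

lemma w_longest_hat:
  assumes "1 \<le> d" "d < n"
  shows "w_longest n (hat n d) = perm_mat n (block_reversal n d)"
proof -
  let ?r = "block_reversal n d"
  have r: "?r permutes {..<n}" using assms by (simp add: block_reversal_permutes)
  have rd: "\<forall>j<n. ?r j < d \<longleftrightarrow> j < d" using assms by (auto simp: block_reversal_def)
  have hat: "hat n d \<subseteq> {1..n - 1}" by (auto simp: hat_def)
  obtain ks where ks: "set ks \<subseteq> hat n d" "s_word n ks = perm_mat n ?r"
    using perm_mat_s_word[OF r rd] by blast
  have mem: "perm_mat n ?r \<in> parabolic n (hat n d)"
    using ks by (auto simp: parabolic_def intro!: exI[of _ ks])
  have longer: "weyl_length n v < weyl_length n (perm_mat n ?r)"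
    if v: "v \<in> parabolic n (hat n d)" "v \<noteq> perm_mat n ?r" for v
  proof -
    obtain vs where vs: "set vs \<subseteq> hat n d" "v = s_word n vs" using v by (auto simp: parabolic_def)
    have "d \<notin> set vs" using vs by (auto simp: hat_def)
    then obtain \<pi> where \<pi>: "\<pi> permutes {..<n}" "v = perm_mat n \<pi>" "\<forall>j<n. \<pi> j < d \<longleftrightarrow> j < d"
      using s_word_perm_mat[of vs n d] vs hat by auto
    obtain us where us: "set us \<subseteq> hat n d" "s_word n us = perm_mat n \<pi>" "length us \<le> card (inversions n \<pi>)"
      using perm_mat_s_word[OF \<pi>(1,3)] by blast
    have "weyl_length n v \<le> length us"
      using weyl_length_le[of us n] us hat \<pi> by auto
    also have "\<dots> \<le> card (inversions n \<pi>)" by fact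
    also have "\<dots> < card (inversions n ?r)"
    proof (rule psubset_card_mono)
      have "inversions n \<pi> \<noteq> inversions n ?r"
        using perm_mat_eq_if_inversions_eq[OF \<pi>(1) r] v \<pi> by auto
      moreover have "inversions n \<pi> \<subseteq> inversions n ?r"
      proof
        fix p assume "p \<in> inversions n \<pi>"
        then obtain i j where ij: "p = (i, j)" "i < j" "j < n" "\<pi> j < \<pi> i" by (auto simp: inversions_def)
        then have "j < d \<or> d \<le> i" using \<pi>(3) by (metis linorder_not_less order.strict_trans order.strict_trans1)
        then show "p \<in> inversions n ?r" using ij by (auto simp: inversions_def block_reversal_def)
      qed
      ultimately show "inversions n \<pi> \<subset> inversions n ?r" by blast
    qed simp
    also have "\<dots> \<le> weyl_length n (perm_mat n ?r)"
      by (rule weyl_length_ge[OF r _ ks(2)]) (use ks hat in auto)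
    finally show ?thesis .
  qed
  show ?thesis
    unfolding w_longest_def
  proof (rule the_equality)
    fix w assume w: "w \<in> parabolic n (hat n d) \<and> (\<forall>v\<in>parabolic n (hat n d). v \<noteq> w \<longrightarrow> weyl_length n v < weyl_length n w)"
    show "w = perm_mat n ?r"
    proof (rule ccontr)
      assume "w \<noteq> perm_mat n ?r"
      then have "weyl_length n w < weyl_length n (perm_mat n ?r)" "weyl_length n (perm_mat n ?r) < weyl_length n w"
        using longer w mem by auto
      then show False by simp
    qed
  qed (use mem longer in blast)
qed

definition rotation :: "nat \<Rightarrow> nat \<Rightarrow> nat \<Rightarrow> nat" where
  "rotation d c j = (if j < d then j + c else if j < d + c then j - d else j)"

lemma rotation_permutes: "rotation d c permutes {..<d + c}"
proof (rule bij_imp_permutes)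
  show "bij_betw (rotation d c) {..<d + c} {..<d + c}"
    by (rule bij_betwI[where g = "rotation c d"]) (auto simp: rotation_def)
qed (auto simp: rotation_def)

lemma w_upper_hat:
  assumes "1 \<le> d" "1 \<le> c"
  shows "w_upper (d + c) (hat (d + c) d) = perm_mat (d + c) (rotation d c)"
proof -
  let ?n = "d + c"
  have "w_zero ?n = perm_mat ?n (\<lambda>j. ?n - 1 - j)"
    by (auto simp: w_zero_def perm_mat_def intro!: eq_matI)
  then have "w_upper ?n (hat ?n d) = perm_mat ?n ((\<lambda>j. ?n - 1 - j) \<circ> block_reversal ?n d)"
    unfolding w_upper_def using assms
    by (simp add: w_longest_hat) (rule perm_mat_mult, auto simp: block_reversal_def)
  also have "\<dots> = perm_mat ?n (rotation d c)"
    by (rule perm_mat_cong) (use assms in \<open>auto simp: block_reversal_def rotation_def\<close>)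
  finally show ?thesis .
qed

lemma card_inversions_rotation: "card (inversions (d + c) (rotation d c)) = d * c"
proof -
  have "inversions (d + c) (rotation d c) = {..<d} \<times> {d..<d + c}"
    by (auto simp: inversions_def rotation_def split: if_splits)
  then show ?thesis by simp
qed

lemma s_word_box_list:
  "s_word (d + c) (map (\<lambda>(i, j). d - i + j) (box_list d c)) = perm_mat (d + c) (rotation d c)"
proof -
  let ?n = "d + c"
  define g where "g k = map (\<lambda>j. d - (d - k) + j) (rev [1..<Suc c])" for k
  \<comment> \<open>The permutation after \<open>k\<close> full rows and \<open>q\<close> more
    letters: a rotation of the first \<open>k + c\<close> positions, with the value
    \<open>k + c\<close> moved \<open>q\<close> places to the left. A full row brings it to position
    \<open>k\<close>, which is the next rotation.\<close>
  define \<rho> where "\<rho> k q j = (if j < k then j + c else if j < k + c - q then j - k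
    else if j = k + c - q then k + c else if j \<le> k + c then j - 1 - k else j)" for k q j :: nat
  have sc: "s_word ?n ks \<in> carrier_mat ?n ?n" for ks
    unfolding s_word_def by (rule mat_list_prod_carrier) auto
  have app: "s_word ?n (as @ bs) = s_word ?n as * s_word ?n bs" for as bs
    unfolding s_word_def map_append by (rule mat_list_prod_append) auto
  have row: "perm_mat ?n (\<rho> k 0) * s_word ?n (map (\<lambda>j. d - (d - k) + j) (rev [Suc c - q..<Suc c])) =
    perm_mat ?n (\<rho> k q)" if k: "k < d" and "q \<le> c" for k q
    using that(2)
  proof (induction q)
    case 0
    then show ?case by (simp add: right_mult_one_mat[of _ ?n ?n])
  next
    case (Suc q)
    have l: "d - (d - k) + (c - q) < ?n" "1 \<le> d - (d - k) + (c - q)" using k Suc.prems by auto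
    have "[Suc c - Suc q..<Suc c] = (c - q) # [Suc c - q..<Suc c]"
      using Suc.prems by (subst upt_conv_Cons) (auto simp: Suc_diff_le)
    then have "map (\<lambda>j. d - (d - k) + j) (rev [Suc c - Suc q..<Suc c]) =
        map (\<lambda>j. d - (d - k) + j) (rev [Suc c - q..<Suc c]) @ [d - (d - k) + (c - q)]"
      by (simp only: rev.simps map_append list.map)
    then have "perm_mat ?n (\<rho> k 0) * s_word ?n (map (\<lambda>j. d - (d - k) + j) (rev [Suc c - Suc q..<Suc c])) =
      (perm_mat ?n (\<rho> k 0) * s_word ?n (map (\<lambda>j. d - (d - k) + j) (rev [Suc c - q..<Suc c])))
        * s_mat ?n (d - (d - k) + (c - q))"
      by (simp only: s_word_snoc) (rule assoc_mult_mat[symmetric, OF perm_mat_carrier sc s_mat_carrier])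
    also have "\<dots> = perm_mat ?n (\<rho> k q \<circ> swp (d - (d - k) + (c - q)))"
      using Suc l by (simp del: upt_Suc add: s_mat_eq_perm_mat perm_mat_mult swp_less)
    also have "\<dots> = perm_mat ?n (\<rho> k (Suc q))"
    proof (rule perm_mat_cong)
      fix j
      have e: "d - (d - k) + (c - q) = k + c - q" "k + c - q - 1 = k + c - Suc q" "k \<le> k + c - Suc q" "k + c - Suc q < k + c - q"
        using k Suc.prems by auto
      show "(\<rho> k q \<circ> swp (d - (d - k) + (c - q))) j = \<rho> k (Suc q) j"
        unfolding e comp_def swp_def \<rho>_def using e(3,4) Suc.prems by auto
    qed
    finally show ?case .
  qed
  have "s_word ?n (concat (map g [0..<q])) = perm_mat ?n (rotation q c)" if "q \<le> d" for q
    using that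
  proof (induction q)
    case 0
    show ?case by (simp add: perm_mat_id[symmetric]) (rule perm_mat_cong, simp add: rotation_def)
  next
    case (Suc q)
    have "perm_mat ?n (rotation q c) = perm_mat ?n (\<rho> q 0)"
      by (rule perm_mat_cong) (auto simp: rotation_def \<rho>_def)
    moreover have "perm_mat ?n (\<rho> q c) = perm_mat ?n (rotation (Suc q) c)"
      by (rule perm_mat_cong) (auto simp: rotation_def \<rho>_def)
    moreover have "concat (map g [0..<Suc q]) = concat (map g [0..<q]) @ g q" by simp
    ultimately show ?case
      using Suc row[of q c] by (simp only: app) (simp add: g_def del: upt_Suc)
  qed
  moreover have "map (\<lambda>(i, j). d - i + j) (box_list d c) = concat (map g [0..<d])"
    unfolding box_list_def g_def map_concat map_map comp_def case_prod_conv ..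
  ultimately show ?thesis by simp
qed

text \<open>The word has \<open>d * c\<close> letters and its permutation has \<open>d * c\<close>
  inversions, so no word is shorter. The permutation is computed along \<open>box_list\<close> and
  transferred by commutation.\<close>

lemma reduced_expression_box_product:
  assumes "1 \<le> d" "1 \<le> c" and enum: "increasing_enum d c ps"
  shows "reduced_expression (d + c) (map (\<lambda>(i, j). d - i + j) ps) (w_upper (d + c) (hat (d + c) d))"
proof -
  let ?n = "d + c" and ?ks = "map (\<lambda>(i, j). d - i + j) ps"
  have sub: "set ?ks \<subseteq> {1..?n - 1}"
    using enum by (auto simp: increasing_enum_def boxes_def)
  \<comment> \<open>A dummy parameter of type unit brings the reflections into the form of
    \<open>increasing_enum_prod_eq\<close>.\<close>
  have conv: "s_word ?n (map (\<lambda>(i, j). d - i + j) qs) =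
    mat_list_prod ?n (map (\<lambda>(i, j). (\<lambda>l a. s_mat ?n l) (d - i + j) ((\<lambda>i j. ()) i j)) qs)" for qs
    unfolding s_word_def by (rule arg_cong[where f = "mat_list_prod ?n"]) auto
  have word: "s_word ?n ?ks = perm_mat ?n (rotation d c)"
    unfolding s_word_box_list[symmetric] conv
    by (rule increasing_enum_prod_eq[OF enum increasing_enum_box_list]) (auto intro: s_mat_commute)
  have len: "length ?ks = d * c"
    using enum distinct_card[of ps] by (simp add: increasing_enum_def boxes_def)
  have "d * c \<le> weyl_length ?n (perm_mat ?n (rotation d c))"
    using weyl_length_ge[OF rotation_permutes sub word] by (simp add: card_inversions_rotation)
  moreover have "weyl_length ?n (perm_mat ?n (rotation d c)) \<le> d * c"
    using weyl_length_le[OF sub] word len by simp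
  ultimately show ?thesis
    unfolding reduced_expression_def w_upper_hat[OF assms(1,2)] using sub word len by simp
qed

subsection \<open>The factorization of the positive points\<close>

definition sn :: "nat \<Rightarrow> real \<Rightarrow> real" where
  "sn n x = sin (x * (pi / real n))"

lemma sn_0 [simp]: "sn n 0 = 0"
  by (simp add: sn_def)

lemma sn_self: "0 < n \<Longrightarrow> sn n (real n) = 0"
  by (simp add: sn_def)

lemma sn_nonzero:
  assumes "0 < x" "x < real n"
  shows "sn n x \<noteq> 0"
proof -
  have "0 < x * (pi / real n)" "x * (pi / real n) < pi"
    using assms by (auto simp: field_simps)
  then show ?thesis unfolding sn_def using sin_gt_zero by fastforce
qed

lemma sn_add: "sn n (x + y) = sn n x * cos (y * (pi / real n)) + cos (x * (pi / real n)) * sn n y"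
  by (simp only: sn_def distrib_right sin_add)

lemma sn_diff: "sn n (x - y) = sn n x * cos (y * (pi / real n)) - cos (x * (pi / real n)) * sn n y"
  by (simp only: sn_def left_diff_distrib sin_diff)

text \<open>Ptolemy's theorem for four points of a circle with inscribed-angle parameters 0,
  \<open>z\<close>, \<open>x\<close>, \<open>y\<close>: the diagonals on the left, the pairs of
  opposite sides on the right.\<close>

lemma sn_ptolemy: "sn n x * sn n (y - z) = sn n (x - z) * sn n y + sn n (y - x) * sn n z"
  unfolding sn_diff by (simp add: algebra_simps)

text \<open>The Gaussian binomial coefficient at the root of unity \<open>exp (2 * pi * \<i> / n)\<close>, normalised
  so that it is real.\<close>

definition sbinom :: "nat \<Rightarrow> nat \<Rightarrow> nat \<Rightarrow> real" where
  "sbinom n m j = (\<Prod>i<j. sn n (real m - real i) / sn n (real i + 1))"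

lemma sbinom_0 [simp]: "sbinom n m 0 = 1"
  by (simp add: sbinom_def)

lemma sbinom_eq_0: "m < j \<Longrightarrow> sbinom n m j = 0"
  unfolding sbinom_def by (rule prod_zero) (auto intro!: bexI[of _ m])

lemma sbinom_Suc: "sbinom n m (Suc j) = sbinom n m j * sn n (real m - real j) / sn n (real j + 1)"
  by (simp add: sbinom_def)

lemma sbinom_Suc_Suc:
  assumes "j \<le> m" "m + 1 < n"
  shows "sbinom n (Suc m) (Suc j) = sbinom n m j * sn n (real m + 1) / sn n (real j + 1)"
proof -
  have "sbinom n (Suc m) (Suc j) =
      (\<Prod>i<Suc j. sn n (real (Suc m) - real i)) / (\<Prod>i<Suc j. sn n (real i + 1))"
    by (simp add: sbinom_def prod_dividef)
  also have "(\<Prod>i<Suc j. sn n (real (Suc m) - real i)) = sn n (real m + 1) * (\<Prod>i<j. sn n (real m - real i))"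
    by (simp only: prod.lessThan_Suc_shift) (simp add: add.commute)
  also have "sn n (real m + 1) * (\<Prod>i<j. sn n (real m - real i)) / (\<Prod>i<Suc j. sn n (real i + 1)) =
      sbinom n m j * sn n (real m + 1) / sn n (real j + 1)"
    by (simp add: sbinom_def prod_dividef mult_ac)
  finally show ?thesis .
qed

text \<open>\<open>hp n x\<close> is the paper's \<open>\<zeta>\<close> to the power \<open>x / 2\<close>.\<close>

definition hp :: "nat \<Rightarrow> real \<Rightarrow> complex" where
  "hp n x = cis (x * (pi / real n))"

lemma hp_add: "hp n (x + y) = hp n x * hp n y"
  by (simp only: hp_def cis_mult distrib_right)

lemma hp_0 [simp]: "hp n 0 = 1" by (simp add: hp_def)

lemma hp_eq: "hp n x = complex_of_real (cos (x * (pi / real n))) + \<i> * complex_of_real (sn n x)"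
  by (simp add: hp_def sn_def complex_eq_iff)

lemma hp_minus_eq: "hp n (- x) = complex_of_real (cos (x * (pi / real n))) - \<i> * complex_of_real (sn n x)"
  by (simp add: hp_def sn_def complex_eq_iff)

text \<open>For quantum integers [x] and q = \<open>hp n 1\<close> this is the rule [x + y] = q^(-y)
  [x] + q^x [y], the source of the q-Pascal rule \<open>sbinom_rec\<close>.\<close>

lemma hp_sn_add: "complex_of_real (sn n (x + y)) = hp n (- y) * sn n x + hp n x * sn n y"
  unfolding sn_add hp_minus_eq[of n y] hp_eq[of n x] by (simp add: algebra_simps)

lemma zeta_pow_hp: "zeta_pow n a = hp n (2 * a)"
  by (simp add: zeta_pow_def hp_def cis_conv_exp mult_ac)

lemma elem_sym_0 [simp]: "elem_sym d z 0 = 1"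
proof -
  have "{S. S \<subseteq> {1..d} \<and> card S = 0} = {{}}"
    by (auto dest: finite_subset)
  then show ?thesis by (simp add: elem_sym_def)
qed

lemma elem_sym_Suc_Suc:
  "elem_sym (Suc d) z (Suc j) = elem_sym d z (Suc j) + z (Suc d) * elem_sym d z j"
proof -
  define A where "A = {S. S \<subseteq> {1..d} \<and> card S = Suc j}"
  define B where "B = {S. S \<subseteq> {1..d} \<and> card S = j}"
  have fin: "finite S" if "S \<subseteq> {1..d}" for S using that finite_subset by blast
  have eq: "{S. S \<subseteq> {1..Suc d} \<and> card S = Suc j} = A \<union> insert (Suc d) ` B"
  proof (intro equalityI subsetI)
    fix S assume S: "S \<in> {S. S \<subseteq> {1..Suc d} \<and> card S = Suc j}"
    show "S \<in> A \<union> insert (Suc d) ` B"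
    proof (cases "Suc d \<in> S")
      case True
      then have "S = insert (Suc d) (S - {Suc d})" by auto
      moreover have "S - {Suc d} \<in> B" using S True by (auto simp: B_def)
      ultimately show ?thesis by blast
    next
      case False
      then show ?thesis using S by (auto simp: A_def le_Suc_eq)
    qed
  next
    fix S assume "S \<in> A \<union> insert (Suc d) ` B"
    then show "S \<in> {S. S \<subseteq> {1..Suc d} \<and> card S = Suc j}"
    proof
      assume "S \<in> insert (Suc d) ` B"
      then obtain T where T: "T \<subseteq> {1..d}" "card T = j" "S = insert (Suc d) T" by (auto simp: B_def)
      then have "Suc d \<notin> T" "finite T" using fin by auto
      then show ?thesis using T by auto
    qed (auto simp: A_def)
  qed
  have inj: "inj_on (insert (Suc d)) B"
  proof (rule inj_onI)
    fix S T assume "S \<in> B" "T \<in> B" "insert (Suc d) S = insert (Suc d) T"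
    moreover from this have "Suc d \<notin> S" "Suc d \<notin> T" by (auto simp: B_def)
    ultimately show "S = T" by (metis insert_ident)
  qed
  have "elem_sym (Suc d) z (Suc j) = (\<Sum>S\<in>A. \<Prod>l\<in>S. z l) + (\<Sum>S\<in>insert (Suc d) ` B. \<Prod>l\<in>S. z l)"
    unfolding elem_sym_def eq
    by (rule sum.union_disjoint) (auto simp: A_def B_def)
  also have "(\<Sum>S\<in>insert (Suc d) ` B. \<Prod>l\<in>S. z l) = (\<Sum>S\<in>B. z (Suc d) * (\<Prod>l\<in>S. z l))"
    unfolding sum.reindex[OF inj] comp_def
  proof (rule sum.cong)
    fix S assume "S \<in> B"
    then have "Suc d \<notin> S" "finite S" using fin by (auto simp: B_def)
    then show "(\<Prod>l\<in>insert (Suc d) S. z l) = z (Suc d) * (\<Prod>l\<in>S. z l)" by simp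
  qed simp
  finally show ?thesis by (simp add: elem_sym_def A_def B_def sum_distrib_left)
qed

lemma elem_sym_eq_0: "d < j \<Longrightarrow> elem_sym d z j = 0"
proof -
  assume "d < j"
  then have "card S \<noteq> j" if "S \<subseteq> {1..d}" for S
    using card_mono[OF _ that] by simp
  then have "{S. S \<subseteq> {1..d} \<and> card S = j} = {}"
    by blast
  then show ?thesis by (simp only: elem_sym_def sum.empty)
qed

lemma sbinom_rec:
  assumes "j \<le> d" "d + 1 < n"
  shows "complex_of_real (sbinom n (Suc d) (Suc j)) =
    hp n (- (real j + 1)) * sbinom n d (Suc j) + hp n (real d - real j) * sbinom n d j"
proof -
  have nz: "sn n (real j + 1) \<noteq> 0" using assms by (intro sn_nonzero) auto
  have "complex_of_real (sn n (real d + 1)) =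
    hp n (- (real j + 1)) * sn n (real d - real j) + hp n (real d - real j) * sn n (real j + 1)"
    using hp_sn_add[of n "real d - real j" "real j + 1"] by simp
  then show ?thesis
    unfolding sbinom_Suc_Suc[OF assms] sbinom_Suc[of n d j] using nz by (simp add: field_simps)
qed

text \<open>The q-binomial theorem for x, xq, ..., xq^(d-1) with q = \<open>hp n 2\<close>. The
  phase combines q^(j(j-1)/2) with the factor q^(j(d-j)/2) by which the Gaussian binomial differs
  from the real \<open>sbinom\<close>. The bound \<open>d < n\<close> keeps the denominators
  nonzero.\<close>

lemma elem_sym_geometric:
  assumes "d < n"
  shows "elem_sym d (\<lambda>l. x * hp n (2 * (real l - 1))) j = x ^ j * hp n (real j * (real d - 1)) * sbinom n d j"
  using assms
proof (induction d arbitrary: j)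
  case 0
  then show ?case by (cases j) (auto simp: elem_sym_eq_0 sbinom_eq_0)
next
  case (Suc d)
  define z where "z = (\<lambda>l. x * hp n (2 * (real l - 1)))"
  show ?case
  proof (cases j)
    case 0
    then show ?thesis by simp
  next
    case (Suc i)
    show ?thesis
    proof (cases "i \<le> d")
      case False
      then show ?thesis using Suc by (simp add: elem_sym_eq_0 sbinom_eq_0)
    next
      case True
      have "elem_sym (Suc d) z (Suc i) = elem_sym d z (Suc i) + z (Suc d) * elem_sym d z i"
        by (rule elem_sym_Suc_Suc)
      also have "\<dots> = x ^ Suc i * hp n (real (Suc i) * (real d - 1)) * sbinom n d (Suc i) +
          x * hp n (2 * real d) * (x ^ i * hp n (real i * (real d - 1)) * sbinom n d i)"
        using Suc.IH[of "Suc i"] Suc.IH[of i] Suc.prems by (simp add: z_def)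
      also have "\<dots> = x ^ Suc i * hp n (real (Suc i) * real d) *
        (hp n (- (real i + 1)) * sbinom n d (Suc i) + hp n (real d - real i) * sbinom n d i)"
      proof -
        have "hp n (real (Suc i) * (real d - 1)) = hp n (real (Suc i) * real d) * hp n (- (real i + 1))"
          by (simp add: hp_add[symmetric] algebra_simps)
        moreover have "hp n (2 * real d) * hp n (real i * (real d - 1)) =
            hp n (real (Suc i) * real d) * hp n (real d - real i)"
          by (simp add: hp_add[symmetric] algebra_simps)
        ultimately show ?thesis by (simp add: algebra_simps)
      qed
      finally show ?thesis
        using sbinom_rec[OF True] Suc.prems Suc by (simp add: z_def)
    qed
  qed
qed

text \<open>Centring the exponents at 0 scales the progression by
  \<open>hp n (- (real d - 1))\<close>, which cancels the phase in
  \<open>elem_sym_geometric\<close>; hence the entries are real.\<close>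

lemma u_pos_eq:
  assumes "d < n"
  shows "u_pos d n t = mat n n (\<lambda>(r, s). if r \<le> s then complex_of_real (t ^ (s - r) * sbinom n d (s - r)) else 0)"
proof -
  have "elem_sym d (\<lambda>l. of_real t * zeta_pow n (- ((real d - 1) / 2) + (real l - 1))) j =
      complex_of_real (t ^ j * sbinom n d j)" for j
  proof -
    have "hp n (2 * (- ((real d - 1) / 2) + (real l - 1))) = hp n (- (real d - 1)) * hp n (2 * (real l - 1))" for l
      unfolding hp_add[symmetric] by (rule arg_cong[where f = "hp n"]) (simp add: field_simps)
    then have "elem_sym d (\<lambda>l. of_real t * zeta_pow n (- ((real d - 1) / 2) + (real l - 1))) j =
      elem_sym d (\<lambda>l. (of_real t * hp n (- (real d - 1))) * hp n (2 * (real l - 1))) j"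
      by (simp add: zeta_pow_hp mult.assoc)
    also have "\<dots> = of_real (t ^ j) * (hp n (- (real d - 1)) ^ j * hp n (real j * (real d - 1))) * sbinom n d j"
      unfolding elem_sym_geometric[OF assms] by (simp add: power_mult_distrib)
    also have "hp n (- (real d - 1)) ^ j = hp n (real j * (- (real d - 1)))"
      by (induction j) (auto simp: hp_add[symmetric] algebra_simps)
    also have "\<dots> * hp n (real j * (real d - 1)) = 1"
      unfolding hp_add[symmetric] by (simp add: algebra_simps)
    finally show ?thesis by simp
  qed
  then show ?thesis
    unfolding u_pos_def u_toeplitz_def
    by (auto intro!: eq_matI simp: sbinom_eq_0)
qed

text \<open>The hook content formula for the shape \<open>(k, \<dots>, k, b)\<close> (\<open>a\<close> columns), divided by that for
  \<open>(k, \<dots>, k)\<close> (\<open>a - 1\<close> columns).\<close>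

definition hook_ratio :: "nat \<Rightarrow> nat \<Rightarrow> nat \<Rightarrow> nat \<Rightarrow> nat \<Rightarrow> real" where
  "hook_ratio n d k a b = (\<Prod>i<b. sn n (real k - real i) * sn n (real d + real a - 1 - real i) /
     (sn n (real i + 1) * sn n (real a + real k - 1 - real i)))"

lemma hook_ratio_0 [simp]: "hook_ratio n d k a 0 = 1"
  by (simp add: hook_ratio_def)

lemma hook_ratio_eq_0: "k < b \<Longrightarrow> hook_ratio n d k a b = 0"
  unfolding hook_ratio_def by (rule prod_zero) (auto intro!: bexI[of _ k])

text \<open>The factor \<open>i = 0\<close> contains sin pi. Taken at \<open>a = c + 1\<close>, this
  says that column \<open>k + c\<close> is still a column of the identity when row
  \<open>k + 1\<close> of the factors begins.\<close>

lemma hook_ratio_eq_0':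
  assumes "d + a = Suc n" "0 < b" "0 < n"
  shows "hook_ratio n d k a b = 0"
proof -
  have "real d + real a - 1 - real 0 = real n" using assms(1) by simp
  then show ?thesis unfolding hook_ratio_def
    using assms by (intro prod_zero bexI[of _ 0]) (simp_all only: sn_self, auto)
qed

lemma hook_ratio_1:
  assumes "b \<le> k" "k < n"
  shows "hook_ratio n d k 1 b = sbinom n d b"
  unfolding hook_ratio_def sbinom_def
proof (rule prod.cong)
  fix i assume "i \<in> {..<b}"
  then have "sn n (real k - real i) \<noteq> 0" using assms by (intro sn_nonzero) auto
  then show "sn n (real k - real i) * sn n (real d + real 1 - 1 - real i) /
    (sn n (real i + 1) * sn n (real 1 + real k - 1 - real i)) = sn n (real d - real i) / sn n (real i + 1)"
    by simp
qed simp

text \<open>After removing what the three terms share, \<open>sn_ptolemy\<close> at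
  \<open>k + 1\<close>, \<open>d + a\<close>, \<open>b + 1\<close> remains.\<close>

lemma hook_ratio_rec:
  assumes "1 \<le> a" "a + k < n"
  shows "hook_ratio n d (Suc k) a (Suc b) = hook_ratio n d k (Suc a) (Suc b) +
    sn n (real d + real a - real (Suc k)) / sn n (real k + real a) * hook_ratio n d k a b"
proof (cases "b \<le> k")
  case False
  then show ?thesis by (simp add: hook_ratio_eq_0)
next
  case True
  define X where "X = (\<Prod>i<b. sn n (real k - real i))"
  define Y where "Y = (\<Prod>i<b. sn n (real d + real a - 1 - real i))"
  define Z where "Z = (\<Prod>i<b. sn n (real i + 1))"
  define W where "W = (\<Prod>i<b. sn n (real a + real k - 1 - real i))"
  have nz: "Z \<noteq> 0" "W \<noteq> 0" "sn n (real b + 1) \<noteq> 0" "sn n (real a + real k) \<noteq> 0"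
    unfolding Z_def W_def using assms True by (simp_all add: sn_nonzero)
  have split: "hook_ratio n d k a b = (\<Prod>i<b. sn n (real k - real i)) * (\<Prod>i<b. sn n (real d + real a - 1 - real i)) /
     ((\<Prod>i<b. sn n (real i + 1)) * (\<Prod>i<b. sn n (real a + real k - 1 - real i)))" for k a b
    by (simp add: hook_ratio_def prod_dividef prod.distrib)
  have 1: "(\<Prod>i<Suc b. sn n (real (Suc k) - real i)) = sn n (real k + 1) * X"
    "(\<Prod>i<Suc b. sn n (real a + real (Suc k) - 1 - real i)) = sn n (real a + real k) * W"
    "(\<Prod>i<Suc b. sn n (real d + real (Suc a) - 1 - real i)) = sn n (real d + real a) * Y"
    "(\<Prod>i<Suc b. sn n (real (Suc a) + real k - 1 - real i)) = sn n (real a + real k) * W"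
    unfolding X_def W_def Y_def prod.lessThan_Suc_shift by (simp_all add: algebra_simps)
  have "sn n (real k + 1) * sn n (real d + real a - (real b + 1)) =
    sn n (real k + 1 - (real b + 1)) * sn n (real d + real a) +
    sn n (real d + real a - (real k + 1)) * sn n (real b + 1)"
    by (rule sn_ptolemy)
  then have pt: "sn n (real k + 1) * sn n (real d + real a - 1 - real b) =
    sn n (real k - real b) * sn n (real d + real a) +
    sn n (real d + real a - real (Suc k)) * sn n (real b + 1)"
    by (simp add: algebra_simps)
  have h1: "hook_ratio n d (Suc k) a (Suc b) =
      sn n (real k + 1) * sn n (real d + real a - 1 - real b) * (X * Y) / (Z * sn n (real b + 1) * sn n (real a + real k) * W)"
    unfolding split 1 by (simp add: Y_def Z_def mult_ac)
  have h2: "hook_ratio n d k (Suc a) (Suc b) =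
      sn n (real k - real b) * sn n (real d + real a) * (X * Y) / (Z * sn n (real b + 1) * sn n (real a + real k) * W)"
    unfolding split 1 by (simp add: X_def Z_def mult_ac)
  have h3: "hook_ratio n d k a b = X * Y / (Z * W)"
    unfolding split by (simp add: X_def Y_def Z_def W_def)
  show ?thesis
    unfolding h1 h2 h3 pt using nz by (simp add: field_simps)
qed

lemma u_pos_factorization:
  assumes n: "n = d + c" "1 \<le> d" "1 \<le> c" and enum: "increasing_enum d c ps"
  shows "u_pos d n t = mat_list_prod n
    (map (\<lambda>(i, j). x_mat n (d - i + j) (complex_of_real (t * (sin (real (i + j - 1) * (pi / real n))
       / sin (real (d - i + j) * (pi / real n)))))) ps)"
proof -
  \<comment> \<open>The explicit \<open>P k\<close>: columns before \<open>k\<close> are final, the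
    next \<open>c\<close> columns hold hook ratios with \<open>a = s - k + 1\<close>, the rest is
    still the identity.\<close>
  define p where "p k r s = (if s < r then 0 else
      if s < k then t ^ (s - r) * sbinom n d (s - r)
      else if s < k + c then t ^ (s - r) * hook_ratio n d k (Suc s - k) (s - r)
      else if r = s then 1 else 0)" for k r s :: nat
  \<comment> \<open>Here \<open>k\<close> counts rows from the bottom: \<open>k = d + 1 - i\<close>
    turns \<open>d + j - k\<close> into \<open>i + j - 1\<close> and \<open>k + j - 1\<close> into
    \<open>d - i + j\<close>.\<close>
  define a where "a k j = t * (sn n (real (d + j - k)) / sn n (real (k + j - 1)))" for k j :: nat
  have "mat n n (\<lambda>(r, s). complex_of_real (p d r s)) =
    mat_list_prod n (map (\<lambda>(i, j). x_mat n (d - i + j) (complex_of_real (a (Suc d - i) j))) ps)"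
  proof (rule mat_eq_box_product[OF n(1) enum, where P = "\<lambda>k r s. complex_of_real (p k r s)"])
    fix r s assume "r < n" "s < n"
    show "complex_of_real (p 0 r s) = (if r = s then 1 else 0)"
      by (auto simp: p_def hook_ratio_eq_0)
  next
    fix k r s assume k: "k < d" and rs: "r < n" "s < n"
    have "p (Suc k) r s = p k r s + (if Suc k \<le> s \<and> s \<le> k + c then a (Suc k) (s - k) * p k r (s - 1) else 0)"
    proof (cases "r \<le> s")
      case False
      then show ?thesis by (auto simp: p_def)
    next
      case rs': True
      consider "s < k" | "s = k" | "Suc k \<le> s" "s \<le> k + c" | "k + c < s" by linarith
      then show ?thesis
      proof cases
        case 2
        then have "hook_ratio n d k (Suc 0) (s - r) = sbinom n d (s - r)"
          using k n rs' hook_ratio_1[of "s - r" k n d] by simp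
        then show ?thesis using 2 n rs' by (auto simp: p_def)
      next
        case 3
        define e where "e = s - k"
        have e: "1 \<le> e" "e \<le> c" "s = k + e" using 3 by (auto simp: e_def)
        \<comment> \<open>For \<open>e = c\<close> the column lies just outside the range of the
          hook formula; the formula extends to it by \<open>hook_ratio_eq_0'\<close>.\<close>
        have pk: "p k r s = t ^ (s - r) * hook_ratio n d k (Suc e) (s - r)"
          using e rs' n by (auto simp: p_def hook_ratio_eq_0')
        have pk1: "p (Suc k) r s = t ^ (s - r) * hook_ratio n d (Suc k) e (s - r)"
          using e rs' by (auto simp: p_def)
        show ?thesis
        proof (cases "r = s")
          case True
          then show ?thesis using 3 pk pk1 by (simp add: p_def)
        next
          case False
          then obtain b where b: "s - r = Suc b" "s - 1 - r = b" using rs' by (cases "s - r") auto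
          have pp: "p k r (s - 1) = t ^ b * hook_ratio n d k e b"
            using e rs' False b by (auto simp: p_def)
          have "hook_ratio n d (Suc k) e (Suc b) = hook_ratio n d k (Suc e) (Suc b) +
            sn n (real d + real e - real (Suc k)) / sn n (real k + real e) * hook_ratio n d k e b"
            by (rule hook_ratio_rec) (use e k n in auto)
          moreover have "real (d + e - Suc k) = real d + real e - real (Suc k)"
            using k by (simp add: of_nat_diff)
          moreover have "a (Suc k) e = t * (sn n (real (d + e - Suc k)) / sn n (real k + real e))"
            by (simp add: a_def)
          ultimately show ?thesis
            using 3 pk pk1 pp b e by (simp add: e_def[symmetric] algebra_simps)
        qed
      qed (auto simp: p_def)
    qed
    then show "complex_of_real (p (Suc k) r s) = complex_of_real (p k r s) +
       (if Suc k \<le> s \<and> s \<le> k + c then complex_of_real (a (Suc k) (s - k)) * complex_of_real (p k r (s - 1)) else 0)"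
      by (auto simp flip: of_real_mult of_real_add)
  qed
  moreover have "mat n n (\<lambda>(r, s). complex_of_real (p d r s)) = u_pos d n t"
  proof -
    have "p d r s = (if r \<le> s then t ^ (s - r) * sbinom n d (s - r) else 0)" if "r < n" "s < n" for r s
    proof -
      \<comment> \<open>At \<open>k = d\<close> the second numerator factor equals the second
        denominator factor, and the quotient becomes a binomial.\<close>
      have "hook_ratio n d d (Suc s - d) (s - r) = sbinom n d (s - r)" if "d \<le> s" "r \<le> s"
      proof (cases "s - r \<le> d")
        case True
        show ?thesis unfolding hook_ratio_def sbinom_def
        proof (rule prod.cong)
          fix i assume i: "i \<in> {..<s - r}"
          have "real d + real (Suc s - d) - 1 - real i = real (Suc s - d) + real d - 1 - real i" by simp
          moreover have "sn n (real (Suc s - d) + real d - 1 - real i) \<noteq> 0"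
            using i True \<open>s < n\<close> \<open>d \<le> s\<close> by (intro sn_nonzero) (auto simp: of_nat_diff)
          ultimately show "sn n (real d - real i) * sn n (real d + real (Suc s - d) - 1 - real i) /
            (sn n (real i + 1) * sn n (real (Suc s - d) + real d - 1 - real i)) =
            sn n (real d - real i) / sn n (real i + 1)"
            by (metis mult_divide_mult_cancel_right)
        qed simp
      qed (simp add: hook_ratio_eq_0 sbinom_eq_0)
      then show ?thesis using that n by (auto simp: p_def)
    qed
    then show ?thesis using n by (subst u_pos_eq) (auto intro!: eq_matI)
  qed
  moreover have "map (\<lambda>(i, j). x_mat n (d - i + j) (complex_of_real (a (Suc d - i) j))) ps =
    map (\<lambda>(i, j). x_mat n (d - i + j) (complex_of_real (t * (sin (real (i + j - 1) * (pi / real n))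
       / sin (real (d - i + j) * (pi / real n)))))) ps"
  proof (rule map_cong[OF refl])
    fix q assume q: "q \<in> set ps"
    obtain i j where ij: "q = (i, j)" by (cases q)
    have "1 \<le> i" "i \<le> d" "1 \<le> j" using q enum ij by (auto simp: increasing_enum_def boxes_def)
    then have "d + j - (Suc d - i) = i + j - 1" "Suc d - i + j - 1 = d - i + j" by auto
    then have "a (Suc d - i) j = t * (sin (real (i + j - 1) * (pi / real n)) / sin (real (d - i + j) * (pi / real n)))"
      unfolding a_def sn_def by (simp only:)
    then show "(case q of (i, j) \<Rightarrow> x_mat n (d - i + j) (complex_of_real (a (Suc d - i) j))) =
      (case q of (i, j) \<Rightarrow> x_mat n (d - i + j) (complex_of_real (t * (sin (real (i + j - 1) * (pi / real n))
       / sin (real (d - i + j) * (pi / real n))))))"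
      by (simp only: ij case_prod_conv)
  qed
  ultimately show ?thesis by simp
qed

subsection \<open>The Bruhat cell and its closure\<close>

text \<open>The block factors through dimension \<open>m\<close>. Padded to size
  \<open>m + 1\<close>, the left factor has a zero column.\<close>

lemma minor_low_rank:
  assumes "\<And>i j. i \<le> m \<Longrightarrow> j \<le> m \<Longrightarrow> f (\<rho> i) (\<sigma> j) = (\<Sum>k<m. A i k * B k j)"
  shows "minor f (Suc m) \<rho> \<sigma> = 0"
proof -
  define M where "M = mat (Suc m) (Suc m) (\<lambda>(i, k). if k < m then A i k else 0)"
  define N where "N = mat (Suc m) (Suc m) (\<lambda>(k, j). if k < m then B k j else 0)"
  have c: "M \<in> carrier_mat (Suc m) (Suc m)" "N \<in> carrier_mat (Suc m) (Suc m)"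
    by (auto simp: M_def N_def)
  have "det M = 0"
    by (subst laplace_expansion_column[OF c(1), of m]) (auto simp: M_def)
  moreover have "M * N = mat (Suc m) (Suc m) (\<lambda>(i, j). f (\<rho> i) (\<sigma> j))"
  proof (rule eq_matI)
    fix i j assume "i < dim_row (mat (Suc m) (Suc m) (\<lambda>(i, j). f (\<rho> i) (\<sigma> j)))"
      "j < dim_col (mat (Suc m) (Suc m) (\<lambda>(i, j). f (\<rho> i) (\<sigma> j)))"
    then have ij: "i < Suc m" "j < Suc m" by auto
    have "(M * N) $$ (i, j) = (\<Sum>k<Suc m. M $$ (i, k) * N $$ (k, j))"
      using ij c by (simp add: scalar_prod_def atLeast0LessThan del: sum.lessThan_Suc)
    also have "\<dots> = (\<Sum>k<m. A i k * B k j)"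
      using ij by (simp add: M_def N_def)
    finally show "(M * N) $$ (i, j) = mat (Suc m) (Suc m) (\<lambda>(i, j). f (\<rho> i) (\<sigma> j)) $$ (i, j)"
      using ij assms[of i j] by simp
  qed (auto simp: M_def N_def)
  ultimately show ?thesis
    using det_mult[OF c] by (simp add: minor_def)
qed

lemma poly_funs_sum:
  assumes "finite A" "\<And>a. a \<in> A \<Longrightarrow> F a \<in> poly_funs n"
  shows "(\<lambda>g. \<Sum>a\<in>A. F a g) \<in> poly_funs n"
  using assms by (induction A) (auto intro: poly_funs.const poly_funs.add)

text \<open>Lets vanishing minors pass from a Bruhat cell to its Zariski closure.\<close>

lemma minor_poly_funs:
  assumes "\<And>i. i < m \<Longrightarrow> \<rho> i < n" "\<And>i. i < m \<Longrightarrow> \<sigma> i < n"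
  shows "(\<lambda>g. minor (\<lambda>i j. g $$ (i, j)) m \<rho> \<sigma>) \<in> poly_funs n"
  using assms
proof (induction m arbitrary: \<sigma>)
  case 0
  then show ?case by (simp add: poly_funs.const)
next
  case (Suc m)
  show ?case
    unfolding minor_last_row
  proof (intro poly_funs_sum poly_funs.mult poly_funs.const poly_funs.entry Suc.IH)
    fix i j :: nat assume "i < m"
    then show "(\<sigma> \<circ> insert_index j) i < n" using Suc.prems(2) by (auto simp: insert_index_def)
  qed (use Suc.prems in auto)
qed

lemma e_sum_index: "r < n \<Longrightarrow> s < n \<Longrightarrow> e_sum n $$ (r, s) = (if s = Suc r then 1 else 0)"
proof -
  assume rs: "r < n" "s < n"
  have "e_sum n $$ (r, s) = (\<Sum>i = 1..n - 1. e_mat n i $$ (r, s))"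
    using rs by (simp add: e_sum_def)
  also have "\<dots> = (\<Sum>i = 1..n - 1. if i = Suc r then if s = Suc r then 1 else 0 else 0)"
    using rs by (intro sum.cong) (auto simp: e_mat_def)
  finally have "e_sum n $$ (r, s) = (\<Sum>i = 1..n - 1. if i = Suc r then if s = Suc r then 1 else 0 else 0)" .
  then show ?thesis using rs by auto
qed

text \<open>Compare the entries \<open>(i, j + 1)\<close> of eu = ue: on the left
  \<open>e_sum\<close> shifts rows, on the right columns.\<close>

lemma U_plus_e_shift:
  assumes u: "u \<in> U_plus_e n" and ij: "Suc i < n" "Suc j < n"
  shows "u $$ (Suc i, Suc j) = u $$ (i, j)"
proof -
  obtain v where v: "v \<in> carrier_mat n n" "inverts_mat v u" "u * e_sum n * v = e_sum n"
    and uc: "u \<in> carrier_mat n n"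
    using u by (auto simp: U_plus_e_def U_plus_def)
  have e: "e_sum n \<in> carrier_mat n n" by (simp add: e_sum_def)
  have "e_sum n * u = (u * e_sum n * v) * u" by (simp add: v)
  also have "\<dots> = (u * e_sum n) * (v * u)"
    by (rule assoc_mult_mat[OF mult_carrier_mat[OF uc e] v(1) uc])
  also have "v * u = 1\<^sub>m n" using v by (auto simp: inverts_mat_def)
  finally have eq: "e_sum n * u = u * e_sum n" using uc e by simp
  have "(e_sum n * u) $$ (i, Suc j) = (\<Sum>k<n. e_sum n $$ (i, k) * u $$ (k, Suc j))"
    using ij uc e by (simp add: scalar_prod_def atLeast0LessThan)
  also have "\<dots> = (\<Sum>k<n. if k = Suc i then u $$ (Suc i, Suc j) else 0)"
    using ij by (intro sum.cong) (auto simp: e_sum_index)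
  finally have 1: "(e_sum n * u) $$ (i, Suc j) = u $$ (Suc i, Suc j)" using ij by simp
  have "(u * e_sum n) $$ (i, Suc j) = (\<Sum>k<n. u $$ (i, k) * e_sum n $$ (k, Suc j))"
    using ij uc e by (simp add: scalar_prod_def atLeast0LessThan)
  also have "\<dots> = (\<Sum>k<n. if k = j then u $$ (i, j) else 0)"
    using ij by (intro sum.cong) (auto simp: e_sum_index)
  finally have 2: "(u * e_sum n) $$ (i, Suc j) = u $$ (i, j)" using ij by simp
  show ?thesis using 1 2 eq by simp
qed

lemma det_nonzero_imp_invertible_mat:
  assumes A: "(A :: complex mat) \<in> carrier_mat n n" and "det A \<noteq> 0"
  shows "invertible_mat A"
proof -
  define B where "B = (1 / det A) \<cdot>\<^sub>m adj_mat A"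
  have adj: "adj_mat A \<in> carrier_mat n n" "A * adj_mat A = det A \<cdot>\<^sub>m 1\<^sub>m n" "adj_mat A * A = det A \<cdot>\<^sub>m 1\<^sub>m n"
    using adj_mat[OF A] by auto
  have "A * B = 1\<^sub>m n"
    unfolding B_def mult_smult_distrib[OF A adj(1)] adj(2) using assms(2)
    by (auto intro!: eq_matI)
  moreover have "B * A = 1\<^sub>m n"
    unfolding B_def mult_smult_assoc_mat[OF adj(1) A] adj(3) using assms(2)
    by (auto intro!: eq_matI)
  moreover have "B \<in> carrier_mat n n" using adj(1) by (simp add: B_def)
  ultimately show ?thesis
    using A by (auto simp: invertible_mat_def inverts_mat_def intro!: exI[of _ B])
qed

lemma invertible_mat_imp_det_nonzero:
  assumes A: "(A :: complex mat) \<in> carrier_mat n n" and "invertible_mat A"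
  shows "det A \<noteq> 0"
proof -
  obtain B where B: "A * B = 1\<^sub>m n" "B * A = 1\<^sub>m (dim_row B)"
    using assms by (auto simp: invertible_mat_def inverts_mat_def)
  have "dim_col B = n" using arg_cong[OF B(1), of dim_col] by simp
  moreover have "dim_row B = n" using arg_cong[OF B(2), of dim_col] A by simp
  ultimately have "B \<in> carrier_mat n n" by auto
  then have "det A * det B = 1" using det_mult[OF A] B(1) by (metis det_one)
  then show ?thesis by auto
qed

lemma B_minusD:
  assumes "b \<in> B_minus n"
  shows "b \<in> carrier_mat n n" "\<And>i j. i < j \<Longrightarrow> j < n \<Longrightarrow> b $$ (i, j) = 0"
    "\<And>i. i < n \<Longrightarrow> b $$ (i, i) \<noteq> 0"
proof -
  show c: "b \<in> carrier_mat n n" using assms by (auto simp: B_minus_def GLn_def)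
  show z: "b $$ (i, j) = 0" if "i < j" "j < n" for i j
    using assms that by (auto simp: B_minus_def)
  fix i assume i: "i < n"
  have "det b \<noteq> 0"
    using assms c invertible_mat_imp_det_nonzero by (auto simp: B_minus_def GLn_def)
  moreover have "det b = (\<Prod>i<n. b $$ (i, i))"
    using det_lower_triangular[OF z c] c by (auto simp: prod_list_diag_prod atLeast0LessThan)
  ultimately show "b $$ (i, i) \<noteq> 0" using i by auto
qed

lemma rotation_mat_mult_index:
  assumes "A \<in> carrier_mat (d + c) (d + c)" "k < d + c" "j < d + c"
  shows "(perm_mat (d + c) (rotation d c) * A) $$ (k, j) = A $$ (if k < c then k + d else k - c, j)"
proof -
  have "(perm_mat (d + c) (rotation d c) * A) $$ (k, j) =
      (\<Sum>l<d + c. perm_mat (d + c) (rotation d c) $$ (k, l) * A $$ (l, j))"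
    using assms by (simp add: scalar_prod_def atLeast0LessThan perm_mat_def)
  also have "\<dots> = (\<Sum>l<d + c. if l = (if k < c then k + d else k - c)
      then A $$ (if k < c then k + d else k - c, j) else 0)"
    using assms by (intro sum.cong) (auto simp: perm_mat_def rotation_def)
  also have "\<dots> = A $$ (if k < c then k + d else k - c, j)"
    using assms by auto
  finally show ?thesis .
qed

text \<open>For \<open>i < c + p\<close> and \<open>j \<ge> p\<close> only \<open>c\<close> of the summands in an entry of \<open>b w b'\<close> survive.\<close>

lemma bruhat_cell_index:
  assumes "g \<in> bruhat_cell (d + c) (perm_mat (d + c) (rotation d c))"
  shows "\<exists>b\<in>B_minus (d + c). \<exists>b'\<in>B_minus (d + c). \<forall>p i j. i < c + p \<longrightarrow> p \<le> j \<longrightarrow> i < d + c \<longrightarrow>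
    j < d + c \<longrightarrow> g $$ (i, j) = (\<Sum>k<c. b $$ (i, k) * b' $$ (k + d, j))"
proof -
  let ?n = "d + c"
  obtain b b' where b: "b \<in> B_minus ?n" "b' \<in> B_minus ?n"
    and g: "g = b * perm_mat ?n (rotation d c) * b'"
    using assms by (auto simp: bruhat_cell_def)
  note bD = B_minusD[OF b(1)] and b'D = B_minusD[OF b(2)]
  have "g $$ (i, j) = (\<Sum>k<c. b $$ (i, k) * b' $$ (k + d, j))"
    if ij: "i < c + p" "p \<le> j" "i < ?n" "j < ?n" for p i j
  proof -
    have "g = b * (perm_mat ?n (rotation d c) * b')"
      unfolding g by (rule assoc_mult_mat[OF bD(1) perm_mat_carrier b'D(1)])
    then have "g $$ (i, j) = (\<Sum>k<?n. b $$ (i, k) * (perm_mat ?n (rotation d c) * b') $$ (k, j))"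
      using ij bD(1) b'D(1) by (simp add: scalar_prod_def atLeast0LessThan perm_mat_def)
    also have "\<dots> = (\<Sum>k<?n. b $$ (i, k) * b' $$ (if k < c then k + d else k - c, j))"
      by (intro sum.cong) (auto simp: rotation_mat_mult_index[OF b'D(1)] ij)
    also have "\<dots> = (\<Sum>k<c. b $$ (i, k) * b' $$ (if k < c then k + d else k - c, j))"
    proof (rule sum.mono_neutral_right)
      show "\<forall>k\<in>{..<?n} - {..<c}. b $$ (i, k) * b' $$ (if k < c then k + d else k - c, j) = 0"
      proof
        \<comment> \<open>One factor lies above a diagonal: if \<open>i < k\<close> fails, then
          \<open>k - c \<le> i - c < p \<le> j\<close>.\<close>
        fix k assume k: "k \<in> {..<?n} - {..<c}"
        show "b $$ (i, k) * b' $$ (if k < c then k + d else k - c, j) = 0"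
        proof (cases "i < k")
          case True
          then show ?thesis using bD(2)[of i k] k by auto
        next
          case False
          then have "k - c < j" using ij k by auto
          then show ?thesis using b'D(2)[of "k - c" j] k ij by auto
        qed
      qed
    qed auto
    finally show ?thesis by simp
  qed
  then show ?thesis using b by blast
qed

text \<open>Rows before \<open>c + p\<close> and columns from \<open>p\<close> on form a block of
  rank at most \<open>c\<close>. The first \<open>c\<close> rows are always included because they
  serve as pivot rows later.\<close>

lemma bruhat_cell_minor_eq_0:
  assumes g: "g \<in> bruhat_cell (d + c) (perm_mat (d + c) (rotation d c))"
    and r: "r < c + p" "r < d + c" and \<sigma>: "\<And>j. j \<le> c \<Longrightarrow> p \<le> \<sigma> j \<and> \<sigma> j < d + c"
  shows "minor (\<lambda>i j. g $$ (i, j)) (Suc c) (\<lambda>i. if i < c then i else r) \<sigma> = 0"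
proof -
  obtain b b' where "b \<in> B_minus (d + c)" "b' \<in> B_minus (d + c)"
    and gb: "\<And>p i j. i < c + p \<Longrightarrow> p \<le> j \<Longrightarrow> i < d + c \<Longrightarrow> j < d + c \<Longrightarrow>
      g $$ (i, j) = (\<Sum>k<c. b $$ (i, k) * b' $$ (k + d, j))"
    using bruhat_cell_index[OF g] by blast
  show ?thesis
    by (rule minor_low_rank[where A = "\<lambda>i k. b $$ (if i < c then i else r, k)" and B = "\<lambda>k j. b' $$ (k + d, \<sigma> j)"])
       (use r \<sigma> in \<open>auto intro!: gb[of _ p]\<close>)
qed

text \<open>Only the summand \<open>k = 0\<close> survives, so the first row is a nonzero multiple
  of row \<open>d\<close> of a lower triangular matrix. The first conclusion is a closed condition
  and passes to the closure; the second is open.\<close>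

lemma bruhat_cell_first_row:
  assumes g: "g \<in> bruhat_cell (d + c) (perm_mat (d + c) (rotation d c))" and c: "1 \<le> c"
  shows "d < k \<Longrightarrow> k < d + c \<Longrightarrow> g $$ (0, k) = 0" "g $$ (0, d) \<noteq> 0"
proof -
  obtain b b' where b: "b \<in> B_minus (d + c)" "b' \<in> B_minus (d + c)"
    and gb: "\<And>p i j. i < c + p \<Longrightarrow> p \<le> j \<Longrightarrow> i < d + c \<Longrightarrow> j < d + c \<Longrightarrow>
      g $$ (i, j) = (\<Sum>k<c. b $$ (i, k) * b' $$ (k + d, j))"
    using bruhat_cell_index[OF g] by blast
  note bD = B_minusD[OF b(1)] and b'D = B_minusD[OF b(2)]
  have eq: "g $$ (0, j) = b $$ (0, 0) * b' $$ (d, j)" if "j < d + c" for j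
  proof -
    have "g $$ (0, j) = (\<Sum>k<c. b $$ (0, k) * b' $$ (k + d, j))"
      by (rule gb[of _ 0]) (use that c in auto)
    also have "\<dots> = (\<Sum>k\<in>{0}. b $$ (0, k) * b' $$ (k + d, j))"
      by (rule sum.mono_neutral_right) (use c bD(2)[of 0] in auto)
    finally show ?thesis by simp
  qed
  show "g $$ (0, k) = 0" if "d < k" "k < d + c"
    using eq[of k] b'D(2)[of d k] that by simp
  show "g $$ (0, d) \<noteq> 0"
    using eq[of d] bD(3)[of 0] b'D(3)[of d] c by simp
qed

text \<open>Block elimination with the invertible top right corner as pivot. The vanishing minors
  make the Schur complement \<open>F\<close> lower triangular (rows counted from \<open>c\<close>),
  so it can fill the last \<open>d\<close> columns of \<open>b\<close>; \<open>b'\<close> records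
  how the columns of the first \<open>c\<close> rows depend on the last \<open>c\<close>
  columns.\<close>

lemma mem_bruhat_cellI:
  assumes u: "u \<in> carrier_mat (d + c) (d + c)" "det u \<noteq> 0"
    and corner: "\<And>i j. i < j \<Longrightarrow> j < c \<Longrightarrow> u $$ (i, d + j) = 0" "\<And>i. i < c \<Longrightarrow> u $$ (i, d + i) \<noteq> 0"
    and minors: "\<And>p r \<sigma>. r < c + p \<Longrightarrow> r < d + c \<Longrightarrow> (\<And>j. j \<le> c \<Longrightarrow> p \<le> \<sigma> j \<and> \<sigma> j < d + c) \<Longrightarrow>
      minor (\<lambda>i j. u $$ (i, j)) (Suc c) (\<lambda>i. if i < c then i else r) \<sigma> = 0"
  shows "u \<in> bruhat_cell (d + c) (perm_mat (d + c) (rotation d c))"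
proof -
  let ?n = "d + c" and ?u = "\<lambda>i j. u $$ (i, j)"
  have "minor ?u c id (\<lambda>j. d + j) = (\<Prod>i<c. u $$ (i, d + i))"
    by (subst minor_lower_triangular) (use corner in auto)
  also have "\<dots> \<noteq> 0" using corner(2) by auto
  finally have piv: "minor ?u c id (\<lambda>j. d + j) \<noteq> 0" .
  have "\<forall>r. \<exists>\<mu>. \<forall>j<c. u $$ (r, d + j) = (\<Sum>i<c. \<mu> i * u $$ (i, d + j))"
    using minor_nonzero_row_span[OF piv] by simp
  then obtain \<mu> where \<mu>: "\<And>r j. j < c \<Longrightarrow> u $$ (r, d + j) = (\<Sum>i<c. \<mu> r i * u $$ (i, d + j))"
    by metis
  have "\<forall>q. \<exists>\<kappa>. \<forall>i<c. u $$ (i, q) = (\<Sum>j<c. \<kappa> j * u $$ (i, d + j))"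
    using minor_nonzero_row_span[OF piv[unfolded minor_transpose[of ?u]]] by simp
  then obtain \<kappa> where \<kappa>: "\<And>q i. i < c \<Longrightarrow> u $$ (i, q) = (\<Sum>j<c. \<kappa> q j * u $$ (i, d + j))"
    by metis
  define F where "F r q = u $$ (r, q) - (\<Sum>i<c. \<mu> r i * u $$ (i, q))" for r q
  have F0: "F r q = 0" if rq: "c \<le> r" "r < q + c" "r < ?n" "q < d" for r q
  proof -
    define \<tau> where "\<tau> j = (if j = 0 then q else d + (j - 1))" for j
    define \<rho> where "\<rho> i = (if i < c then i else r)" for i
    \<comment> \<open>The least \<open>p\<close> with \<open>r < c + p\<close> is
      \<open>Suc r - c\<close>; it is at most \<open>q\<close> because
      \<open>r < q + c\<close>.\<close>
    have "0 = minor ?u (Suc c) \<rho> \<tau>"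
      unfolding \<rho>_def by (rule minors[of r "Suc r - c", symmetric]) (use rq in \<open>auto simp: \<tau>_def\<close>)
    also have "\<dots> = (\<Sum>j<Suc c. F r (\<tau> j) * ((-1) ^ (c + j) * minor ?u c \<rho> (\<tau> \<circ> insert_index j)))"
    proof -
      have "?u (\<rho> c) (\<tau> j) + (\<Sum>l<c. - \<mu> r l * ?u (\<rho> l) (\<tau> j)) = F r (\<tau> j)" for j
        by (simp add: F_def \<rho>_def sum_negf)
      then show ?thesis
        by (subst minor_last_row_eliminated[where \<mu> = "\<lambda>l. - \<mu> r l"]) simp
    qed
    also have "\<dots> = (\<Sum>j\<in>{0}. F r (\<tau> j) * ((-1) ^ (c + j) * minor ?u c \<rho> (\<tau> \<circ> insert_index j)))"
    proof (rule sum.mono_neutral_right)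
      show "\<forall>j\<in>{..<Suc c} - {0}. F r (\<tau> j) * ((-1) ^ (c + j) * minor ?u c \<rho> (\<tau> \<circ> insert_index j)) = 0"
      proof
        fix j assume "j \<in> {..<Suc c} - {0}"
        then have "0 < j" "j - 1 < c" by auto
        then have "F r (\<tau> j) = 0" using \<mu>[of "j - 1" r] by (simp add: F_def \<tau>_def)
        then show "F r (\<tau> j) * ((-1) ^ (c + j) * minor ?u c \<rho> (\<tau> \<circ> insert_index j)) = 0" by simp
      qed
    qed auto
    also have "\<dots> = F r q * ((-1) ^ c * minor ?u c id (\<lambda>j. d + j))"
    proof -
      have "minor ?u c \<rho> (\<tau> \<circ> insert_index 0) = minor ?u c id (\<lambda>j. d + j)"
        by (rule minor_cong) (simp add: \<rho>_def \<tau>_def)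
      then show ?thesis by (simp add: \<tau>_def)
    qed
    finally show ?thesis using piv by simp
  qed
  \<comment> \<open>In the product the first \<open>c\<close> columns of \<open>b\<close> meet the
    rows of \<open>b'\<close> from \<open>d\<close> on, and the other columns meet the first
    \<open>d\<close> rows, which are rows of the identity.\<close>
  define b where "b = mat ?n ?n (\<lambda>(r, k). if k < c then u $$ (r, d + k) else if r < c then 0 else F r (k - c))"
  define b' where "b' = mat ?n ?n (\<lambda>(k, q). if k = q then 1 else if d \<le> k \<and> q < d then \<kappa> q (k - d) else 0)"
  let ?w = "perm_mat ?n (rotation d c)"
  have bc: "b \<in> carrier_mat ?n ?n" "b' \<in> carrier_mat ?n ?n" by (auto simp: b_def b'_def)
  have bw: "b * (?w * b') = u"
  proof (rule eq_matI)
    fix r q assume "r < dim_row u" "q < dim_col u"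
    then have rq: "r < ?n" "q < ?n" using u by auto
    have "(b * (?w * b')) $$ (r, q) = (\<Sum>k<?n. b $$ (r, k) * (?w * b') $$ (k, q))"
      using rq bc by (simp add: scalar_prod_def atLeast0LessThan perm_mat_def)
    also have "\<dots> = (\<Sum>k<?n. b $$ (r, k) * b' $$ (if k < c then k + d else k - c, q))"
      by (intro sum.cong) (auto simp: rotation_mat_mult_index[OF bc(2)] rq)
    also have "\<dots> = (\<Sum>k<c. b $$ (r, k) * b' $$ (k + d, q)) + (\<Sum>k\<in>{c..<?n}. b $$ (r, k) * b' $$ (k - c, q))"
    proof -
      have "{..<?n} = {..<c} \<union> {c..<?n}" by auto
      then show ?thesis by (simp add: sum.union_disjoint ivl_disj_int)
    qed
    also have "(\<Sum>k\<in>{c..<?n}. b $$ (r, k) * b' $$ (k - c, q)) =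
        (\<Sum>k\<in>{c..<?n}. if k = q + c then if q < d then if r < c then 0 else F r q else 0 else 0)"
    proof (rule sum.cong)
      fix k assume k: "k \<in> {c..<?n}"
      then have "k - c < d" "k - c < ?n" "k - c = q \<longleftrightarrow> k = q + c" by auto
      moreover from this have "k = q + c \<Longrightarrow> q < d" by auto
      ultimately show "b $$ (r, k) * b' $$ (k - c, q) =
          (if k = q + c then if q < d then if r < c then 0 else F r q else 0 else 0)"
        using rq k by (simp add: b_def b'_def)
    qed simp
    also have "\<dots> = (if q < d then if r < c then 0 else F r q else 0)" by auto
    also have "(\<Sum>k<c. b $$ (r, k) * b' $$ (k + d, q)) =
      (if q < d then \<Sum>k<c. \<kappa> q k * u $$ (r, d + k) else u $$ (r, q))"
    proof (cases "q < d")
      case True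
      then show ?thesis using rq by (auto simp: b_def b'_def intro!: sum.cong)
    next
      case False
      then have "(\<Sum>k<c. b $$ (r, k) * b' $$ (k + d, q)) = (\<Sum>k<c. if k = q - d then u $$ (r, q) else 0)"
        using rq by (intro sum.cong) (auto simp: b_def b'_def)
      then show ?thesis using False rq by simp
    qed
    also have "(\<Sum>k<c. \<kappa> q k * u $$ (r, d + k)) = u $$ (r, q) - (if r < c then 0 else F r q)"
    proof (cases "r < c")
      case True
      then show ?thesis by (simp add: \<kappa>[of r q])
    next
      case False
      have "(\<Sum>k<c. \<kappa> q k * u $$ (r, d + k)) = (\<Sum>k<c. \<kappa> q k * (\<Sum>i<c. \<mu> r i * u $$ (i, d + k)))"
        by (intro sum.cong) (auto simp: \<mu>[of _ r])
      also have "\<dots> = (\<Sum>i<c. \<mu> r i * (\<Sum>k<c. \<kappa> q k * u $$ (i, d + k)))"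
        by (simp add: sum_distrib_left mult_ac) (rule sum.swap)
      also have "\<dots> = (\<Sum>i<c. \<mu> r i * u $$ (i, q))"
        by (intro sum.cong) (auto simp flip: \<kappa>)
      finally show ?thesis using False by (simp add: F_def)
    qed
    finally show "(b * (?w * b')) $$ (r, q) = u $$ (r, q)" by simp
  qed (use u bc in \<open>auto simp: perm_mat_def\<close>)
  have "det b' = (\<Prod>i<?n. b' $$ (i, i))"
    using bc by (subst det_lower_triangular[of ?n]) (auto simp: b'_def prod_list_diag_prod atLeast0LessThan)
  then have "det b' \<noteq> 0" by (simp add: b'_def)
  then have b': "b' \<in> B_minus ?n"
    using bc(2) det_nonzero_imp_invertible_mat[OF bc(2)] by (auto simp: B_minus_def GLn_def b'_def)
  \<comment> \<open>Invertibility of \<open>b\<close> is inherited from \<open>u\<close>, so the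
    diagonal of \<open>F\<close> need not be examined.\<close>
  have "det b * det (?w * b') = det u"
    using bc det_mult[of b ?n "?w * b'"] bw by (simp add: mult_carrier_mat[of _ ?n ?n])
  then have "det b \<noteq> 0" using u by auto
  then have b: "b \<in> B_minus ?n"
    using bc(1) det_nonzero_imp_invertible_mat[OF bc(1)] corner(1) F0
    by (auto simp: B_minus_def GLn_def b_def)
  have "u = b * ?w * b'" using bw assoc_mult_mat[OF bc(1) perm_mat_carrier bc(2)] by simp
  then show ?thesis using b b' by (auto simp: bruhat_cell_def)
qed

text \<open>Commuting with e gives the Toeplitz form. The zeros of the first row and the rank
  conditions are polynomial equations on the cell, hence hold on its closure.\<close>

lemma V_varD:
  assumes u: "u \<in> V_var d (d + c)" and dc: "1 \<le> d" "1 \<le> c"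
  shows "u \<in> carrier_mat (d + c) (d + c)" "det u = 1"
    "\<And>i j. i < d + c \<Longrightarrow> j < d + c \<Longrightarrow> u $$ (i, j) = x_coord d u (int j - int i)"
    "\<And>p r \<sigma>. r < c + p \<Longrightarrow> r < d + c \<Longrightarrow> (\<And>j. j \<le> c \<Longrightarrow> p \<le> \<sigma> j \<and> \<sigma> j < d + c) \<Longrightarrow>
      minor (\<lambda>i j. u $$ (i, j)) (Suc c) (\<lambda>i. if i < c then i else r) \<sigma> = 0"
proof -
  let ?n = "d + c" and ?C = "bruhat_cell (d + c) (perm_mat (d + c) (rotation d c))"
  have e: "u \<in> U_plus_e ?n" and cl: "u \<in> zariski_closure ?n ?C"
    using u by (auto simp: V_var_def w_upper_hat[OF dc])
  show c: "u \<in> carrier_mat ?n ?n" using e by (auto simp: U_plus_e_def U_plus_def)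
  have ut: "upper_triangular u" and diag: "\<And>i. i < ?n \<Longrightarrow> u $$ (i, i) = 1"
    using e by (auto simp: U_plus_e_def U_plus_def)
  show "det u = 1"
    using det_upper_triangular[OF ut c] c diag by (auto simp: prod_list_diag_prod)
  have shift: "u $$ (i + k, j + k) = u $$ (i, j)" if "i + k < ?n" "j + k < ?n" for i j k
    using that by (induction k) (auto simp: U_plus_e_shift[OF e])
  have row0: "u $$ (0, k) = 0" if k: "d < k" "k < ?n" for k
  proof -
    have "(\<lambda>g. g $$ (0, k)) \<in> poly_funs ?n" using k by (intro poly_funs.entry) auto
    then show ?thesis
      using cl bruhat_cell_first_row(1)[OF _ dc(2) k] by (auto simp: zariski_closure_def)
  qed
  show "u $$ (i, j) = x_coord d u (int j - int i)" if ij: "i < ?n" "j < ?n" for i j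
  proof (cases "i \<le> j")
    case True
    then have "u $$ (i, j) = u $$ (0, j - i)" using shift[of 0 i "j - i"] ij by simp
    moreover have "int j - int i = int (j - i)" using True by simp
    ultimately show ?thesis
      using row0[of "j - i"] diag[of i] ij by (cases "i = j") (simp_all add: x_coord_def del: of_nat_diff)
  next
    case False
    then have "u $$ (i, j) = 0" using ut ij c by (auto simp: upper_triangular_def)
    then show ?thesis using False by (simp add: x_coord_def)
  qed
  fix p r \<sigma>
  assume r: "r < c + p" "r < ?n" and \<sigma>: "\<And>j. j \<le> c \<Longrightarrow> p \<le> \<sigma> j \<and> \<sigma> j < ?n"
  have "(\<lambda>g. minor (\<lambda>i j. g $$ (i, j)) (Suc c) (\<lambda>i. if i < c then i else r) \<sigma>) \<in> poly_funs ?n"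
    by (rule minor_poly_funs) (use r \<sigma> in auto)
  then show "minor (\<lambda>i j. u $$ (i, j)) (Suc c) (\<lambda>i. if i < c then i else r) \<sigma> = 0"
    using cl bruhat_cell_minor_eq_0[OF _ r \<sigma>] by (auto simp: zariski_closure_def)
qed

subsection \<open>Total nonnegativity\<close>

text \<open>Increasing index functions replace index sets, so that a single column index can be
  altered.\<close>

definition tnn :: "nat \<Rightarrow> complex mat \<Rightarrow> bool" where
  "tnn n A \<longleftrightarrow> (\<forall>m \<rho> \<sigma>. strict_mono_on {..<m} \<rho> \<longrightarrow> strict_mono_on {..<m} \<sigma> \<longrightarrow>
     \<rho> ` {..<m} \<subseteq> {..<n} \<longrightarrow> \<sigma> ` {..<m} \<subseteq> {..<n} \<longrightarrow> minor (\<lambda>i j. A $$ (i, j)) m \<rho> \<sigma> \<in> \<real>\<^sub>\<ge>\<^sub>0)"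

lemma pick_image_strict_mono:
  assumes "strict_mono_on {..<m} \<rho>" "i < m"
  shows "pick (\<rho> ` {..<m}) i = \<rho> i"
proof -
  have "{a \<in> \<rho> ` {..<m}. a < \<rho> i} = \<rho> ` {..<i}"
  proof (intro equalityI subsetI)
    fix a assume "a \<in> {a \<in> \<rho> ` {..<m}. a < \<rho> i}"
    then obtain k where k: "k < m" "a = \<rho> k" "\<rho> k < \<rho> i" by auto
    then have "k < i" using assms by (metis lessThan_iff linorder_cases not_less_iff_gr_or_eq strict_mono_onD)
    then show "a \<in> \<rho> ` {..<i}" using k by auto
  next
    fix a assume "a \<in> \<rho> ` {..<i}"
    then show "a \<in> {a \<in> \<rho> ` {..<m}. a < \<rho> i}"
      using assms by (auto intro: strict_mono_onD)
  qed
  moreover have "inj_on \<rho> {..<i}"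
    using strict_mono_on_imp_inj_on[OF assms(1)] assms(2) by (auto intro: inj_on_subset)
  ultimately have "card {a \<in> \<rho> ` {..<m}. a < \<rho> i} = i" by (simp add: card_image)
  then show ?thesis using pick_card_in_set[of "\<rho> i" "\<rho> ` {..<m}"] assms(2) by auto
qed

lemma totally_nonneg_iff_tnn:
  assumes A: "A \<in> carrier_mat n n"
  shows "totally_nonneg A \<longleftrightarrow> tnn n A"
proof
  assume nn: "totally_nonneg A"
  show "tnn n A"
    unfolding tnn_def
  proof (intro allI impI)
    fix m :: nat and \<rho> \<sigma> :: "nat \<Rightarrow> nat"
    assume mono: "strict_mono_on {..<m} \<rho>" "strict_mono_on {..<m} \<sigma>"
      and sub: "\<rho> ` {..<m} \<subseteq> {..<n}" "\<sigma> ` {..<m} \<subseteq> {..<n}"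
    have card: "card (\<rho> ` {..<m}) = m" "card (\<sigma> ` {..<m}) = m"
      using strict_mono_on_imp_inj_on[OF mono(1)] strict_mono_on_imp_inj_on[OF mono(2)] by (auto simp: card_image)
    have eq: "{i. i < n \<and> i \<in> \<rho> ` {..<m}} = \<rho> ` {..<m}" "{i. i < n \<and> i \<in> \<sigma> ` {..<m}} = \<sigma> ` {..<m}"
      using sub by auto
    have "submatrix A (\<rho> ` {..<m}) (\<sigma> ` {..<m}) = mat m m (\<lambda>(i, j). A $$ (\<rho> i, \<sigma> j))"
      using A unfolding submatrix_def by (auto intro!: eq_matI simp: eq card pick_image_strict_mono mono)
    moreover have "det (submatrix A (\<rho> ` {..<m}) (\<sigma> ` {..<m})) \<in> \<real>\<^sub>\<ge>\<^sub>0"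
      using nn sub card A by (simp add: totally_nonneg_def)
    ultimately show "minor (\<lambda>i j. A $$ (i, j)) m \<rho> \<sigma> \<in> \<real>\<^sub>\<ge>\<^sub>0" by (simp add: minor_def)
  qed
next
  assume nn: "tnn n A"
  show "totally_nonneg A"
    unfolding totally_nonneg_def
  proof (intro allI impI)
    fix I J assume IJ: "I \<subseteq> {..<dim_row A} \<and> J \<subseteq> {..<dim_col A} \<and> card I = card J"
    have eq: "{i. i < n \<and> i \<in> I} = I" "{j. j < n \<and> j \<in> J} = J" using IJ A by auto
    have fin: "finite I" "finite J" using IJ finite_subset by blast+
    have mono: "strict_mono_on {..<card I} (pick I)" "strict_mono_on {..<card J} (pick J)"
      by (auto intro!: strict_mono_onI pick_mono)
    have sub: "pick I ` {..<card I} \<subseteq> {..<n}" "pick J ` {..<card J} \<subseteq> {..<n}"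
      using IJ A pick_in_set_le[of _ I] pick_in_set_le[of _ J] by blast+
    have "det (submatrix A I J) = minor (\<lambda>i j. A $$ (i, j)) (card I) (pick I) (pick J)"
      using A IJ by (simp add: submatrix_def minor_def eq)
    then show "det (submatrix A I J) \<in> \<real>\<^sub>\<ge>\<^sub>0"
      using nn mono sub IJ by (simp add: tnn_def)
  qed
qed

lemma minor_col_linear:
  assumes "p < m" and "\<And>i j. i < m \<Longrightarrow> j < m \<Longrightarrow> j \<noteq> p \<Longrightarrow> f (\<rho> i) (\<sigma> j) = g (\<rho> i) (\<sigma> j)"
    and "\<And>i. i < m \<Longrightarrow> f (\<rho> i) (\<sigma> p) = g (\<rho> i) (\<sigma> p) + a * g (\<rho> i) k"
  shows "minor f m \<rho> \<sigma> = minor g m \<rho> \<sigma> + a * minor g m \<rho> (\<sigma>(p := k))"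
proof -
  obtain m' where m: "m = Suc m'" using assms(1) by (cases m) auto
  have p: "p \<le> m'" using assms(1) m by simp
  have ins: "insert_index i l < m" if "l < m'" for i l using that m by (auto simp: insert_index_def)
  have ne: "insert_index p l \<noteq> p" for l by (auto simp: insert_index_def)
  have "minor f m' (\<rho> \<circ> insert_index i) (\<sigma> \<circ> insert_index p) = minor g m' (\<rho> \<circ> insert_index i) (\<sigma> \<circ> insert_index p)" for i
    by (rule minor_cong) (simp add: assms(2) ins ne)
  moreover have "minor g m' (\<rho> \<circ> insert_index i) (\<sigma>(p := k) \<circ> insert_index p) = minor g m' (\<rho> \<circ> insert_index i) (\<sigma> \<circ> insert_index p)" for i
    by (rule minor_cong) (simp add: ne)
  ultimately show ?thesis
    unfolding m minor_laplace_col[OF p] sum_distrib_left sum.distrib[symmetric]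
    by (intro sum.cong) (auto simp: assms(3) m algebra_simps)
qed

text \<open>A minor using column \<open>l\<close> gains \<open>a\<close> times the minor with
  \<open>l\<close> replaced by \<open>l - 1\<close>. Either \<open>l - 1\<close> already occurs and
  that minor vanishes, or the indices remain increasing.\<close>

lemma tnn_mult_x_mat:
  assumes A: "A \<in> carrier_mat n n" "tnn n A" and l: "1 \<le> l" "l < n" and a: "a \<in> \<real>\<^sub>\<ge>\<^sub>0"
  shows "tnn n (A * x_mat n l a)"
  unfolding tnn_def
proof (intro allI impI)
  fix m :: nat and \<rho> \<sigma> :: "nat \<Rightarrow> nat"
  assume mono: "strict_mono_on {..<m} \<rho>" "strict_mono_on {..<m} \<sigma>"
    and sub: "\<rho> ` {..<m} \<subseteq> {..<n}" "\<sigma> ` {..<m} \<subseteq> {..<n}"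
  let ?A = "\<lambda>i j. A $$ (i, j)" and ?B = "\<lambda>i j. (A * x_mat n l a) $$ (i, j)"
  have B: "?B i j = ?A i j + (if j = l then a * ?A i (l - 1) else 0)" if "i < n" "j < n" for i j
    using that by (simp add: mult_x_mat[OF A(1) l])
  have nn: "minor ?A m \<rho> \<sigma>' \<in> \<real>\<^sub>\<ge>\<^sub>0" if "strict_mono_on {..<m} \<sigma>'" "\<sigma>' ` {..<m} \<subseteq> {..<n}" for \<sigma>'
    using A(2) mono sub that by (simp add: tnn_def)
  show "minor ?B m \<rho> \<sigma> \<in> \<real>\<^sub>\<ge>\<^sub>0"
  proof (cases "l \<in> \<sigma> ` {..<m}")
    case False
    then have "minor ?B m \<rho> \<sigma> = minor ?A m \<rho> \<sigma>"
      using sub by (intro minor_cong) (auto simp: B image_subset_iff)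
    then show ?thesis using nn mono sub by simp
  next
    case True
    then obtain p where p: "p < m" "\<sigma> p = l" by auto
    have ne: "\<sigma> j \<noteq> l" if "j < m" "j \<noteq> p" for j
      using strict_mono_on_imp_inj_on[OF mono(2)] p that by (auto dest: inj_onD)
    have eq: "minor ?B m \<rho> \<sigma> = minor ?A m \<rho> \<sigma> + a * minor ?A m \<rho> (\<sigma>(p := l - 1))"
    proof (rule minor_col_linear[OF p(1)])
      fix i j assume "i < m" "j < m" "j \<noteq> p"
      then show "?B (\<rho> i) (\<sigma> j) = ?A (\<rho> i) (\<sigma> j)"
        using sub B[of "\<rho> i" "\<sigma> j"] ne[of j] by auto
    next
      fix i assume "i < m"
      then show "?B (\<rho> i) (\<sigma> p) = ?A (\<rho> i) (\<sigma> p) + a * ?A (\<rho> i) (l - 1)"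
        using sub B[of "\<rho> i" "\<sigma> p"] p by auto
    qed
    show ?thesis
    proof (cases "\<exists>q<m. q \<noteq> p \<and> \<sigma> q = l - 1")
      case True
      then obtain q where q: "q < m" "q \<noteq> p" "\<sigma> q = l - 1" by blast
      have "minor ?A m \<rho> (\<sigma>(p := l - 1)) = 0"
        by (rule minor_same_cols[of p m q]) (use p q in auto)
      then show ?thesis using eq nn mono sub by simp
    next
      case False
      have "strict_mono_on {..<m} (\<sigma>(p := l - 1))"
      proof (rule strict_mono_onI)
        fix r s assume rs: "r \<in> {..<m}" "s \<in> {..<m}" "r < s"
        then have "\<sigma> r < \<sigma> s" using mono(2) by (auto intro: strict_mono_onD)
        then show "(\<sigma>(p := l - 1)) r < (\<sigma>(p := l - 1)) s"
        proof (cases "s = p")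
          case True
          then have "r \<noteq> p" "r < m" "\<sigma> r < l" using rs p \<open>\<sigma> r < \<sigma> s\<close> by auto
          then have "\<sigma> r \<noteq> l - 1" using False by blast
          then show ?thesis using True \<open>\<sigma> r < l\<close> \<open>r \<noteq> p\<close> by auto
        next
          case s: False
          then show ?thesis using \<open>\<sigma> r < \<sigma> s\<close> p by (cases "r = p") auto
        qed
      qed
      moreover have "(\<sigma>(p := l - 1)) ` {..<m} \<subseteq> {..<n}" using sub l by auto
      ultimately show ?thesis
        unfolding eq using a nn mono sub by (auto intro: nonneg_Reals_add_I nonneg_Reals_mult_I)
    qed
  qed
qed

text \<open>If the last row and column indices differ, the larger one belongs to a zero row or
  column; if they agree, the minor reduces to a smaller one.\<close>

lemma tnn_one: "tnn n (1\<^sub>m n)"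
  unfolding tnn_def
proof (intro allI impI)
  fix m :: nat and \<rho> \<sigma> :: "nat \<Rightarrow> nat"
  assume "strict_mono_on {..<m} \<rho>" "strict_mono_on {..<m} \<sigma>" "\<rho> ` {..<m} \<subseteq> {..<n}" "\<sigma> ` {..<m} \<subseteq> {..<n}"
  then show "minor (\<lambda>i j. (1\<^sub>m n :: complex mat) $$ (i, j)) m \<rho> \<sigma> \<in> \<real>\<^sub>\<ge>\<^sub>0"
  proof (induction m)
    case 0
    then show ?case by simp
  next
    case (Suc m)
    let ?f = "\<lambda>i j. (1\<^sub>m n :: complex mat) $$ (i, j)"
    have less: "\<rho> i < \<rho> m" "\<sigma> i < \<sigma> m" if "i < m" for i
      using Suc.prems(1,2) that by (auto intro: strict_mono_onD)
    have bd: "\<rho> i < n" "\<sigma> i < n" if "i < Suc m" for i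
      using Suc.prems(3,4) that by auto
    have IH: "minor ?f m \<rho> \<sigma> \<in> \<real>\<^sub>\<ge>\<^sub>0"
      by (rule Suc.IH) (use Suc.prems(1,2) bd in \<open>auto simp: monotone_on_def\<close>)
    consider "\<rho> m = \<sigma> m" | "\<sigma> m < \<rho> m" | "\<rho> m < \<sigma> m" by linarith
    then show ?case
    proof cases
      case 1
      have "minor ?f (Suc m) \<rho> \<sigma> = (\<Sum>j\<in>{m}. ?f (\<rho> m) (\<sigma> j) * ((-1) ^ (m + j) * minor ?f m \<rho> (\<sigma> \<circ> insert_index j)))"
        unfolding minor_last_row
      proof (rule sum.mono_neutral_right)
        have "?f (\<rho> m) (\<sigma> j) = 0" if "j < m" for j
          using less(2)[OF that] 1 bd[of m] bd[of j] that by simp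
        then show "\<forall>j\<in>{..<Suc m} - {m}. ?f (\<rho> m) (\<sigma> j) * ((-1) ^ (m + j) * minor ?f m \<rho> (\<sigma> \<circ> insert_index j)) = 0"
          by auto
      qed auto
      moreover have "minor ?f m \<rho> (\<sigma> \<circ> insert_index m) = minor ?f m \<rho> \<sigma>"
        by (rule minor_cong) (simp add: insert_index_def)
      ultimately show ?thesis using IH 1 bd[of m] by simp
    next
      case 2
      have "?f (\<rho> m) (\<sigma> j) = 0" if "j < Suc m" for j
      proof -
        have "\<sigma> j \<noteq> \<rho> m" using that 2 less(2)[of j] by (cases "j = m") auto
        then show ?thesis using bd that by auto
      qed
      then have "minor ?f (Suc m) \<rho> \<sigma> = 0" unfolding minor_last_row by simp
      then show ?thesis by simp
    next
      case 3
      have "?f (\<rho> i) (\<sigma> m) = 0" if "i < Suc m" for i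
      proof -
        have "\<rho> i \<noteq> \<sigma> m" using that 3 less(1)[of i] by (cases "i = m") auto
        then show ?thesis using bd that by auto
      qed
      then have "minor ?f (Suc m) \<rho> \<sigma> = 0" unfolding minor_last_col by simp
      then show ?thesis by simp
    qed
  qed
qed

lemma tnn_x_mat_product:
  assumes "\<And>l a. (l, a) \<in> set ws \<Longrightarrow> 1 \<le> l \<and> l < n \<and> a \<in> \<real>\<^sub>\<ge>\<^sub>0"
  shows "tnn n (mat_list_prod n (map (\<lambda>(l, a). x_mat n l a) ws))"
  using assms
proof (induction ws rule: rev_induct)
  case Nil
  then show ?case by (simp add: tnn_one)
next
  case (snoc w ws)
  obtain l a where w: "w = (l, a)" by (cases w)
  have c: "mat_list_prod n (map (\<lambda>(l, a). x_mat n l a) ws) \<in> carrier_mat n n"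
    by (rule mat_list_prod_carrier) auto
  have "mat_list_prod n (map (\<lambda>(l, a). x_mat n l a) (ws @ [w])) =
    mat_list_prod n (map (\<lambda>(l, a). x_mat n l a) ws) * x_mat n l a"
    unfolding map_append
    by (subst mat_list_prod_append) (auto simp: w right_mult_one_mat[of _ n n])
  then show ?case
    using tnn_mult_x_mat[OF c snoc.IH, of l a] snoc.prems by (auto simp: w)
qed

subsection \<open>Toeplitz matrices\<close>

text \<open>Shrinks the Jacobi-Trudi determinant of a rectangle from \<open>c\<close> to
  \<open>m\<close> rows: the remaining rows come from zero parts of the conjugate partition.\<close>

lemma minor_unitriangular_tail:
  assumes "\<And>i j. m \<le> i \<Longrightarrow> i < m + q \<Longrightarrow> j < i \<Longrightarrow> f (\<rho> i) (\<sigma> j) = 0"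
    and "\<And>i. m \<le> i \<Longrightarrow> i < m + q \<Longrightarrow> f (\<rho> i) (\<sigma> i) = 1"
  shows "minor f (m + q) \<rho> \<sigma> = minor f m \<rho> \<sigma>"
  using assms
proof (induction q)
  case 0
  then show ?case by simp
next
  case (Suc q)
  have "minor f (Suc (m + q)) \<rho> \<sigma> = (\<Sum>j\<in>{m + q}. f (\<rho> (m + q)) (\<sigma> j) *
      ((-1) ^ (m + q + j) * minor f (m + q) \<rho> (\<sigma> \<circ> insert_index j)))"
    unfolding minor_last_row
    by (rule sum.mono_neutral_right) (use Suc.prems(1) in auto)
  moreover have "minor f (m + q) \<rho> (\<sigma> \<circ> insert_index (m + q)) = minor f (m + q) \<rho> \<sigma>"
    by (rule minor_cong) (simp add: insert_index_def)
  moreover have "minor f (m + q) \<rho> \<sigma> = minor f m \<rho> \<sigma>"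
    by (rule Suc.IH) (use Suc.prems in auto)
  ultimately show ?case using Suc.prems(2)[of "m + q"] by simp
qed

locale banded_toeplitz =
  fixes d c :: nat and X :: "int \<Rightarrow> complex"
  assumes d_pos: "1 \<le> d" and c_pos: "1 \<le> c"
    and X_0: "X 0 = 1" and X_neg: "\<And>k. k < 0 \<Longrightarrow> X k = 0" and X_large: "\<And>k. int d < k \<Longrightarrow> X k = 0"
begin

definition T :: "nat \<Rightarrow> nat \<Rightarrow> complex" where
  "T i j = X (int j - int i)"

definition D :: "nat \<Rightarrow> nat \<Rightarrow> complex" where
  "D m k = minor T m id (\<lambda>j. k + j)"

text \<open>\<open>D (Suc m) k\<close> with its last row replaced by row \<open>r\<close>. The
  quotient \<open>N m k r / D m k\<close> is a Schur complement: row \<open>r\<close> of column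
  \<open>k + m\<close>, reduced by the columns \<open>k, ..., k + m - 1\<close> so as to vanish in
  the rows before \<open>m\<close>.\<close>

definition N :: "nat \<Rightarrow> nat \<Rightarrow> nat \<Rightarrow> complex" where
  "N m k r = minor T (Suc m) (\<lambda>i. if i < m then i else r) (\<lambda>j. k + j)"

lemma D_0 [simp]: "D 0 k = 1"
  by (simp add: D_def)

lemma D_m_0 [simp]: "D m 0 = 1"
  unfolding D_def by (subst minor_upper_triangular) (auto simp: T_def X_0 X_neg)

lemma D_m_d: "D m d = X (int d) ^ m"
  unfolding D_def by (subst minor_lower_triangular) (auto simp: T_def X_large)

lemma N_last_row_single:
  assumes "\<And>j. j < m \<Longrightarrow> T r (k + j) = 0"
  shows "N m k r = T r (k + m) * D m k"
proof -
  have "N m k r = (\<Sum>j\<in>{m}. T (if m < m then m else r) (k + j) *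
      ((-1) ^ (m + j) * minor T m (\<lambda>i. if i < m then i else r) ((\<lambda>j. k + j) \<circ> insert_index j)))"
    unfolding N_def minor_last_row by (rule sum.mono_neutral_right) (use assms in auto)
  moreover have "minor T m (\<lambda>i. if i < m then i else r) ((\<lambda>j. k + j) \<circ> insert_index m) = D m k"
    unfolding D_def by (rule minor_cong) (simp add: insert_index_def)
  ultimately show ?thesis by simp
qed

lemma N_last_col_single:
  assumes "\<And>i. i < m \<Longrightarrow> T i (k + m) = 0"
  shows "N m k r = T r (k + m) * D m k"
proof -
  have "N m k r = (\<Sum>i\<in>{m}. T (if i < m then i else r) (k + m) *
      ((-1) ^ (i + m) * minor T m ((\<lambda>i. if i < m then i else r) \<circ> insert_index i) (\<lambda>j. k + j)))"
    unfolding N_def minor_last_col by (rule sum.mono_neutral_right) (use assms in auto)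
  moreover have "minor T m ((\<lambda>i. if i < m then i else r) \<circ> insert_index m) (\<lambda>j. k + j) = D m k"
    unfolding D_def by (rule minor_cong) (simp add: insert_index_def)
  ultimately show ?thesis by simp
qed

lemma N_less_eq_0: "r < m \<Longrightarrow> N m k r = 0"
  unfolding N_def by (rule minor_same_rows[of r _ m]) auto

text \<open>Divided by \<open>D (Suc m) k * D m (Suc k)\<close>, this is the recurrence for the
  quotients \<open>N / D\<close>, with coefficient \<open>chamber (Suc k) (Suc m)\<close>.\<close>

lemma N_desnanot_jacobi:
  assumes "D m (Suc k) \<noteq> 0"
  shows "N (Suc m) k r * D m (Suc k) = N m (Suc k) r * D (Suc m) k - N m k r * D (Suc m) (Suc k)"
proof -
  define \<gamma> where "\<gamma> i = (if i < Suc m then i else r)" for i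
  define \<rho> where "\<rho> i = (if i < m then i else r)" for i
  define \<tau> where "\<tau> j = k + j" for j
  have piv: "minor T m (\<gamma> \<circ> id) (\<tau> \<circ> Suc) = D m (Suc k)"
    unfolding D_def by (rule minor_cong) (simp add: \<gamma>_def \<tau>_def)
  have "minor T m (\<gamma> \<circ> id) (\<tau> \<circ> Suc) \<noteq> 0"
    unfolding piv by (rule assms)
  then have "minor T (Suc (Suc m)) \<gamma> \<tau> * D m (Suc k) =
      minor T (Suc m) \<rho> (\<tau> \<circ> Suc) * minor T (Suc m) \<gamma> \<tau> -
      minor T (Suc m) \<rho> \<tau> * minor T (Suc m) \<gamma> (\<tau> \<circ> Suc)"
    unfolding piv[symmetric] by (rule desnanot_jacobi[rotated]) (simp_all add: \<gamma>_def \<rho>_def)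
  moreover have "minor T (Suc (Suc m)) \<gamma> \<tau> = N (Suc m) k r"
    unfolding N_def by (rule minor_cong) (simp add: \<gamma>_def \<tau>_def)
  moreover have "minor T (Suc m) \<rho> (\<tau> \<circ> Suc) = N m (Suc k) r"
    unfolding N_def by (rule minor_cong) (simp add: \<rho>_def \<tau>_def)
  moreover have "minor T (Suc m) \<gamma> \<tau> = D (Suc m) k"
    unfolding D_def by (rule minor_cong) (simp add: \<gamma>_def \<tau>_def)
  moreover have "minor T (Suc m) \<rho> \<tau> = N m k r"
    unfolding N_def by (rule minor_cong) (simp add: \<rho>_def \<tau>_def)
  moreover have "minor T (Suc m) \<gamma> (\<tau> \<circ> Suc) = D (Suc m) (Suc k)"
    unfolding D_def by (rule minor_cong) (simp add: \<gamma>_def \<tau>_def)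
  ultimately show ?thesis by simp
qed

text \<open>A ratio of four minors as in the Chamber Ansatz; \<open>k = d + 1 - i\<close> counts
  rows from the bottom.\<close>

definition chamber :: "nat \<Rightarrow> nat \<Rightarrow> complex" where
  "chamber k j = D j k * D (j - 1) (k - 1) / (D (j - 1) k * D j (k - 1))"

lemma toeplitz_factorization:
  assumes D: "\<And>m k. m \<le> c \<Longrightarrow> k \<le> d \<Longrightarrow> D m k \<noteq> 0"
    and minors: "\<And>p r \<sigma>. r < c + p \<Longrightarrow> r < d + c \<Longrightarrow> (\<And>j. j \<le> c \<Longrightarrow> p \<le> \<sigma> j \<and> \<sigma> j < d + c) \<Longrightarrow>
      minor T (Suc c) (\<lambda>i. if i < c then i else r) \<sigma> = 0"
    and enum: "increasing_enum d c ps"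
  shows "mat (d + c) (d + c) (\<lambda>(i, j). T i j) =
    mat_list_prod (d + c) (map (\<lambda>(i, j). x_mat (d + c) (d - i + j) (chamber (Suc d - i) j)) ps)"
proof -
  define P where "P k r s = (if s < k then T r s else if s < k + c then N (s - k) k r / D (s - k) k
    else if r = s then 1 else 0)" for k r s
  \<comment> \<open>At column \<open>k + c\<close> the quotient formula must reproduce the identity
    column: rows before \<open>k + c\<close> vanish by the rank conditions, later rows by
    triangularity.\<close>
  have edge: "N c k r / D c k = (if r = k + c then 1 else 0)" if "k < d" "r < d + c" for k r
  proof (cases "r < k + c")
    case True
    have "N c k r = 0"
      unfolding N_def by (rule minors[of r k]) (use True that in auto)
    then show ?thesis using True by simp
  next
    case False
    have "N c k r = T r (k + c) * D c k"
      by (rule N_last_row_single) (use False in \<open>auto simp: T_def X_neg\<close>)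
    then show ?thesis using False D[of c k] that by (auto simp: T_def X_0 X_neg)
  qed
  have "mat (d + c) (d + c) (\<lambda>(r, s). P d r s) =
    mat_list_prod (d + c) (map (\<lambda>(i, j). x_mat (d + c) (d - i + j) (chamber (Suc d - i) j)) ps)"
  proof (rule mat_eq_box_product[OF refl enum])
    fix r s
    have "N s 0 r = (if r = s then 1 else 0)"
    proof (cases "r < s")
      case True
      then show ?thesis by (simp add: N_less_eq_0)
    next
      case False
      have "N s 0 r = T r (0 + s) * D s 0"
        by (rule N_last_row_single) (use False in \<open>auto simp: T_def X_neg\<close>)
      then show ?thesis using False by (auto simp: T_def X_0 X_neg)
    qed
    then show "P 0 r s = (if r = s then 1 else 0)" by (auto simp: P_def)
  next
    fix k r s assume k: "k < d" and rs: "r < d + c" "s < d + c"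
    consider "s < k" | "s = k" | "Suc k \<le> s" "s \<le> k + c" | "k + c < s" by linarith
    then show "P (Suc k) r s = P k r s +
      (if Suc k \<le> s \<and> s \<le> k + c then chamber (Suc k) (s - k) * P k r (s - 1) else 0)"
    proof cases
      case 2
      have "N 0 k r = T r k" using N_last_row_single[of 0 r k] by simp
      then show ?thesis using 2 c_pos by (simp add: P_def)
    next
      case 3
      define m where "m = s - Suc k"
      have m: "s = k + Suc m" "Suc m \<le> c" "m < c" using 3 by (auto simp: m_def)
      have p0: "P k r s = N (Suc m) k r / D (Suc m) k"
      proof (cases "Suc m = c")
        case True
        show ?thesis unfolding True edge[OF k rs(1)] using m(1) True by (auto simp: P_def)
      qed (use m in \<open>simp add: P_def\<close>)
      have p1: "P k r (s - 1) = N m k r / D m k" and p2: "P (Suc k) r s = N m (Suc k) r / D m (Suc k)"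
        using m by (auto simp: P_def)
      have nz: "D m k \<noteq> 0" "D (Suc m) k \<noteq> 0" "D m (Suc k) \<noteq> 0" "D (Suc m) (Suc k) \<noteq> 0"
        using D m k by auto
      have ch: "chamber (Suc k) (s - k) = D (Suc m) (Suc k) * D m k / (D m (Suc k) * D (Suc m) k)"
        using m by (simp add: chamber_def)
      show ?thesis
        unfolding p0 p1 p2 ch using 3 nz N_desnanot_jacobi[OF nz(3), of r]
        by (simp add: field_simps)
    qed (auto simp: P_def)
  qed
  \<comment> \<open>For \<open>s \<ge> d\<close> the band makes all but the last entry of the last
    column of \<open>N\<close> vanish, leaving \<open>T r s\<close>.\<close>
  moreover have "P d r s = T r s" if "s < d + c" for r s
  proof (cases "s < d")
    case False
    have "N (s - d) d r = T r (d + (s - d)) * D (s - d) d"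
      by (rule N_last_col_single) (auto simp: T_def X_large)
    then show ?thesis using False that D[of "s - d" d] by (simp add: P_def)
  qed (simp add: P_def)
  ultimately show ?thesis by (metis (mono_tags, lifting) cong_mat case_prod_conv)
qed

text \<open>A vanishing \<open>D m k\<close>, with \<open>m\<close> and then \<open>k\<close> minimal, propagates to the right: by
  Desnanot--Jacobi every column beyond the first \<open>k\<close> lies in a fixed hyperplane, which is
  impossible because the last \<open>c\<close> columns are triangular.\<close>

lemma D_nonzero_if_tnn:
  assumes nn: "\<And>m \<rho> \<sigma>. strict_mono_on {..<m} \<rho> \<Longrightarrow> strict_mono_on {..<m} \<sigma> \<Longrightarrow>
      \<rho> ` {..<m} \<subseteq> {..<d + c} \<Longrightarrow> \<sigma> ` {..<m} \<subseteq> {..<d + c} \<Longrightarrow> minor T m \<rho> \<sigma> \<in> \<real>\<^sub>\<ge>\<^sub>0"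
    and Xd: "X (int d) \<noteq> 0"
  shows "m \<le> c \<Longrightarrow> k \<le> d \<Longrightarrow> D m k \<noteq> 0"
proof (induction m arbitrary: k)
  case 0
  then show ?case by simp
next
  case (Suc m)
  note outer = Suc.IH and mc = Suc.prems(1)
  from Suc.prems(2) show ?case
  proof (induction k)
    case 0
    then show ?case by simp
  next
    case (Suc k)
    define K where "K = Suc k"
    have K: "K \<le> d" "D m K \<noteq> 0" "D (Suc m) k \<noteq> 0"
      using Suc outer[of K] mc by (auto simp: K_def)
    show ?case
    proof
      assume "D (Suc m) (Suc k) = 0"
      then have D0: "D (Suc m) K = 0" by (simp add: K_def)
      have "K \<noteq> d" using D0 D_m_d[of "Suc m"] Xd by auto
      with K have Kd: "K < d" by simp
      have shift: "minor T l Suc (\<lambda>i. Suc q + i) = D l q" for l q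
        unfolding D_def by (rule minor_cong) (simp add: T_def)
      define col where "col j i = (if i < m then Suc K + i else j)" for j i
      have zero: "minor T (Suc m) id (col j) = 0" if j: "K < j" "j < d + c" for j
      proof (cases "j \<le> K + m")
        case True
        show ?thesis
          by (rule minor_same_cols[of "j - Suc K" _ m]) (use True j in \<open>auto simp: col_def\<close>)
      next
        case False
        \<comment> \<open>Desnanot--Jacobi with the middle rows \<open>1, ..., m\<close> as pivot
          (\<open>\<iota> = Suc\<close>). Since \<open>D (Suc m) K = 0\<close>, two nonnegative
          products sum to 0, and the nonzero factor \<open>D (Suc m) k\<close> forces its partner to
          vanish.\<close>
        define \<tau> where "\<tau> i = (if i \<le> m then K + i else j)" for i
        have piv: "minor T m (id \<circ> Suc) (\<tau> \<circ> Suc) = D m K"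
          unfolding shift[symmetric] by (rule minor_cong) (simp add: \<tau>_def)
        have "minor T m (id \<circ> Suc) (\<tau> \<circ> Suc) \<noteq> 0"
          unfolding piv by (rule K)
        then have "minor T (Suc (Suc m)) id \<tau> * D m K =
          minor T (Suc m) Suc (\<tau> \<circ> Suc) * minor T (Suc m) id \<tau> -
          minor T (Suc m) Suc \<tau> * minor T (Suc m) id (\<tau> \<circ> Suc)"
          unfolding piv[symmetric] by (rule desnanot_jacobi[rotated]) simp_all
        moreover have "minor T (Suc m) id \<tau> = D (Suc m) K"
          unfolding D_def by (rule minor_cong) (simp add: \<tau>_def)
        moreover have "minor T (Suc m) Suc \<tau> = D (Suc m) k"
          unfolding shift[symmetric] by (rule minor_cong) (simp add: \<tau>_def K_def)
        moreover have "minor T (Suc m) id (\<tau> \<circ> Suc) = minor T (Suc m) id (col j)"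
          by (rule minor_cong) (auto simp: \<tau>_def col_def)
        ultimately have eq: "minor T (Suc (Suc m)) id \<tau> * D m K + D (Suc m) k * minor T (Suc m) id (col j) = 0"
          using D0 by simp
        have nnD: "D l q \<in> \<real>\<^sub>\<ge>\<^sub>0" if "l \<le> c" "q \<le> d" for l q
          unfolding D_def by (rule nn) (use that in \<open>auto simp: strict_mono_on_def monotone_on_def\<close>)
        have "minor T (Suc (Suc m)) id \<tau> \<in> \<real>\<^sub>\<ge>\<^sub>0"
          by (rule nn) (use False j mc K Kd d_pos in \<open>auto simp: monotone_on_def \<tau>_def\<close>)
        moreover have "minor T (Suc m) id (col j) \<in> \<real>\<^sub>\<ge>\<^sub>0"
          by (rule nn) (use False j mc K Kd in \<open>auto simp: monotone_on_def col_def\<close>)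
        moreover have "D m K \<in> \<real>\<^sub>\<ge>\<^sub>0" "D (Suc m) k \<in> \<real>\<^sub>\<ge>\<^sub>0"
          using nnD[of m K] nnD[of "Suc m" k] mc K Suc.prems by auto
        ultimately show ?thesis using eq K(3)
          by (auto elim!: nonneg_Reals_cases simp flip: of_real_mult of_real_add)
             (metis add_nonneg_eq_0_iff mult_eq_0_iff mult_nonneg_nonneg of_real_0)
      qed
      define e where "e i = Suc K + i" for i
      \<comment> \<open>The cofactors of the last column are independent of \<open>j\<close>: they
        are the normal vector of the hyperplane.\<close>
      define w where "w i = (-1) ^ (i + m) * minor T m (id \<circ> insert_index i) e" for i
      have w: "(\<Sum>i<Suc m. T i j * w i) = 0" if j: "K < j" "j < d + c" for j
      proof -
        have "minor T m (id \<circ> insert_index i) (col j) = minor T m (id \<circ> insert_index i) e" for i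
          by (rule minor_cong) (simp add: col_def e_def)
        then have "minor T (Suc m) id (col j) = (\<Sum>i<Suc m. T i j * w i)"
          unfolding minor_last_col w_def by (simp add: col_def)
        then show ?thesis using zero[OF j] by simp
      qed
      \<comment> \<open>In column \<open>d + l\<close> the rows above \<open>l\<close> are zero and
        row \<open>l\<close> is \<open>X d\<close>; so the coordinates of \<open>w\<close> vanish
        one after another from row \<open>m\<close> upwards.\<close>
      have w0: "w (m - q) = 0" if "q \<le> m" for q
        using that
      proof (induction q rule: less_induct)
        case (less q)
        let ?l = "m - q"
        have wz: "w i = 0" if "?l < i" "i \<le> m" for i
          using less.IH[of "m - i"] that less.prems by simp
        have "(\<Sum>i<Suc m. T i (d + ?l) * w i) = (\<Sum>i\<in>{?l}. T i (d + ?l) * w i)"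
        proof (rule sum.mono_neutral_right)
          show "\<forall>i\<in>{..<Suc m} - {?l}. T i (d + ?l) * w i = 0"
          proof
            fix i assume i: "i \<in> {..<Suc m} - {?l}"
            show "T i (d + ?l) * w i = 0"
            proof (cases "?l < i")
              case True
              then show ?thesis using wz[of i] i by simp
            next
              case False
              then show ?thesis using i X_large[of "int (d + ?l) - int i"] by (simp add: T_def)
            qed
          qed
        qed auto
        moreover have "(\<Sum>i<Suc m. T i (d + ?l) * w i) = 0"
          by (rule w) (use Kd mc in auto)
        ultimately show ?case using Xd by (simp add: T_def)
      qed
      \<comment> \<open>Deleting row 0 shifts the block along the diagonals, so \<open>w 0\<close>
        is \<open>D m K\<close> up to sign, nonzero by minimality of \<open>m\<close>.\<close>
      have "minor T m (id \<circ> insert_index 0) e = D m K"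
        unfolding shift[symmetric] by (rule minor_cong) (simp add: e_def)
      then show False using w0[of m] K(2) by (simp add: w_def)
    qed
  qed
qed

end

section \<open>Rectangular Schur functions and positivity\<close>

lemma conj_part_rect_part:
  assumes "k \<le> d" "1 \<le> j"
  shows "conj_part (rect_part d m k) j = (if j \<le> m then k else 0)"
proof -
  have "i < length (rect_part d m k) \<and> j \<le> rect_part d m k ! i \<longleftrightarrow> i < k \<and> j \<le> m" for i
  proof (cases "i < d")
    case True
    then show ?thesis using assms by (cases "i < k") (simp_all add: rect_part_def nth_append)
  qed (use assms in \<open>auto simp: rect_part_def\<close>)
  then have "{i. i < length (rect_part d m k) \<and> j \<le> rect_part d m k ! i} = (if j \<le> m then {..<k} else {})"
    by auto
  then show ?thesis by (simp add: conj_part_def)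
qed

lemma V_var_iff_positive_rectangles:
  assumes dc: "1 \<le> d" "1 \<le> c" and u: "u \<in> V_var d (d + c)"
  shows "u \<in> V_pos d (d + c) \<longleftrightarrow> (\<forall>m k. 1 \<le> m \<and> m \<le> c \<and> 1 \<le> k \<and> k \<le> d \<longrightarrow>
    schur_fun d c (rect_part d m k) u \<in> \<real> \<and> Re (schur_fun d c (rect_part d m k) u) > 0)"
proof -
  let ?n = "d + c"
  note V = V_varD[OF u dc]
  interpret banded_toeplitz d c "x_coord d u"
    by unfold_locales (use dc in \<open>auto simp: x_coord_def\<close>)
  have uT: "u $$ (i, j) = T i j" if "i < ?n" "j < ?n" for i j
    using V(3)[OF that] by (simp add: T_def)
  have minor_uT: "minor (\<lambda>i j. u $$ (i, j)) m \<rho> \<sigma> = minor T m \<rho> \<sigma>"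
    if "\<And>i. i < m \<Longrightarrow> \<rho> i < ?n" "\<And>i. i < m \<Longrightarrow> \<sigma> i < ?n" for m \<rho> \<sigma>
    by (rule minor_cong) (simp add: uT that)
  have schur: "schur_fun d c (rect_part d m k) u = D m k" if mk: "m \<le> c" "k \<le> d" for m k
  proof -
    define f where "f i j = x_coord d u (int (if i < m then k else 0) + int j - int i)" for i j :: nat
    have "schur_fun d c (rect_part d m k) u = minor f c id id"
      unfolding schur_fun_def minor_def f_def
      using mk by (intro arg_cong[where f = det] eq_matI) (auto simp: conj_part_rect_part)
    also have "\<dots> = minor f m id id"
      using minor_unitriangular_tail[of m "c - m" f id id] mk by (simp add: f_def x_coord_def)
    also have "\<dots> = D m k"
      unfolding D_def by (rule minor_cong) (simp add: f_def T_def)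
    finally show ?thesis .
  qed
  have w: "w_upper ?n (hat ?n d) = perm_mat ?n (rotation d c)" by (rule w_upper_hat[OF dc])
  have Xd: "u $$ (0, d) = x_coord d u (int d)" using uT[of 0 d] dc by (simp add: T_def)
  have pos_iff: "(z \<in> \<real> \<and> Re z > 0) \<longleftrightarrow> z \<in> \<real>\<^sub>\<ge>\<^sub>0 \<and> z \<noteq> 0" for z
    by (auto simp: complex_nonneg_Reals_iff complex_is_Real_iff complex_eq_iff)
  have tnn_iff: "totally_nonneg u \<longleftrightarrow> tnn ?n u" by (rule totally_nonneg_iff_tnn[OF V(1)])
  show ?thesis
  proof
    assume "u \<in> V_pos d ?n"
    then have cell: "u \<in> bruhat_cell ?n (perm_mat ?n (rotation d c))" and tn: "tnn ?n u"
      by (auto simp: V_pos_def w tnn_iff)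
    have nn: "minor T m \<rho> \<sigma> \<in> \<real>\<^sub>\<ge>\<^sub>0" if "strict_mono_on {..<m} \<rho>" "strict_mono_on {..<m} \<sigma>"
      "\<rho> ` {..<m} \<subseteq> {..<?n}" "\<sigma> ` {..<m} \<subseteq> {..<?n}" for m \<rho> \<sigma>
    proof -
      have "minor (\<lambda>i j. u $$ (i, j)) m \<rho> \<sigma> = minor T m \<rho> \<sigma>"
        by (rule minor_uT) (use that in auto)
      then show ?thesis using tn[unfolded tnn_def, rule_format, OF that] by simp
    qed
    have "D m k \<in> \<real>\<^sub>\<ge>\<^sub>0" if "m \<le> c" "k \<le> d" for m k
      unfolding D_def by (rule nn) (use that in \<open>auto simp: monotone_on_def\<close>)
    moreover have "D m k \<noteq> 0" if "m \<le> c" "k \<le> d" for m k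
      using D_nonzero_if_tnn[OF nn] that bruhat_cell_first_row(2)[OF cell dc(2)] Xd by simp
    ultimately show "\<forall>m k. 1 \<le> m \<and> m \<le> c \<and> 1 \<le> k \<and> k \<le> d \<longrightarrow>
      schur_fun d c (rect_part d m k) u \<in> \<real> \<and> Re (schur_fun d c (rect_part d m k) u) > 0"
      by (simp add: schur pos_iff)
  next
    assume pos: "\<forall>m k. 1 \<le> m \<and> m \<le> c \<and> 1 \<le> k \<and> k \<le> d \<longrightarrow>
      schur_fun d c (rect_part d m k) u \<in> \<real> \<and> Re (schur_fun d c (rect_part d m k) u) > 0"
    have Dpos: "D m k \<in> \<real>\<^sub>\<ge>\<^sub>0 \<and> D m k \<noteq> 0" if "m \<le> c" "k \<le> d" for m k
    proof (cases "m = 0 \<or> k = 0")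
      case False
      then show ?thesis using pos that by (auto simp: schur pos_iff)
    qed auto
    have minors: "minor T (Suc c) (\<lambda>i. if i < c then i else r) \<sigma> = 0"
      if "r < c + p" "r < ?n" "\<And>j. j \<le> c \<Longrightarrow> p \<le> \<sigma> j \<and> \<sigma> j < ?n" for p r \<sigma>
      by (subst minor_uT[symmetric]) (use V(4)[OF that] that dc in auto)
    have chamber: "chamber k j \<in> \<real>\<^sub>\<ge>\<^sub>0" if "1 \<le> k" "k \<le> d" "1 \<le> j" "j \<le> c" for k j
      unfolding chamber_def using Dpos that
      by (auto simp: divide_inverse intro!: nonneg_Reals_mult_I nonneg_Reals_inverse_I)
    obtain ps where enum: "increasing_enum d c ps" using ex_increasing_enum by blast
    have "u = mat ?n ?n (\<lambda>(i, j). T i j)"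
      using V(1) by (auto intro!: eq_matI simp: uT)
    also have "\<dots> = mat_list_prod ?n (map (\<lambda>(i, j). x_mat ?n (d - i + j) (chamber (Suc d - i) j)) ps)"
      by (rule toeplitz_factorization[OF _ minors enum]) (use Dpos in auto)
    also have "\<dots> = mat_list_prod ?n (map (\<lambda>(l, a). x_mat ?n l a) (map (\<lambda>(i, j). (d - i + j, chamber (Suc d - i) j)) ps))"
      by (rule arg_cong[where f = "mat_list_prod ?n"]) auto
    also have "tnn ?n \<dots>"
      by (rule tnn_x_mat_product)
         (use enum in \<open>auto simp: increasing_enum_def boxes_def intro!: chamber\<close>)
    finally have "tnn ?n u" .
    \<comment> \<open>The diagonal of the top right corner consists of \<open>D 1 d\<close>, the
      coordinate x_d, so its positivity puts \<open>u\<close> into the open cell.\<close>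
    moreover have "u \<in> bruhat_cell ?n (perm_mat ?n (rotation d c))"
    proof (rule mem_bruhat_cellI[OF V(1) _ _ _ V(4)])
      show "det u \<noteq> 0" by (simp add: V(2))
      show "u $$ (i, d + j) = 0" if "i < j" "j < c" for i j
        using that by (simp add: uT T_def X_large)
      show "u $$ (i, d + i) \<noteq> 0" if "i < c" for i
        using that Dpos[of 1 d] dc by (simp add: uT T_def D_m_d)
    qed
    ultimately show "u \<in> V_pos d ?n" using u by (simp add: V_pos_def w tnn_iff)
  qed
qed

theorem proposition9p3:
  fixes n d c :: nat
  assumes "n \<ge> 2" and "1 \<le> d" and "d \<le> n - 1" and "c = n - d"
  shows "(\<forall>(t :: real) ps. increasing_enum d c ps \<longrightarrow>
            u_pos d n t = mat_list_prod n
              (map (\<lambda>(i, j). x_mat n (d - i + j)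
                  (complex_of_real (t * (sin (real (i + j - 1) * (pi / real n))
                                         / sin (real (d - i + j) * (pi / real n)))))) ps)
            \<and> reduced_expression n (map (\<lambda>(i, j). d - i + j) ps) (w_upper n (hat n d)))
       \<and> (\<forall>u \<in> V_var d n. u \<in> V_pos d n \<longleftrightarrow>
            (\<forall>m k. 1 \<le> m \<and> m \<le> c \<and> 1 \<le> k \<and> k \<le> d \<longrightarrow>
               schur_fun d c (rect_part d m k) u \<in> \<real>
               \<and> Re (schur_fun d c (rect_part d m k) u) > 0))"
proof -
  have n: "n = d + c" and c: "1 \<le> c" using assms by auto
  show ?thesis
    using u_pos_factorization[OF n assms(2) c] reduced_expression_box_product[OF assms(2) c]
      V_var_iff_positive_rectangles[OF assms(2) c]
    unfolding n by blast
qed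

end
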